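(* Let $m,J$ (with $m(\cdot,\tau),J(\cdot,\tau)\in V_h$, continuously differentiable in $\tau$, and $J>0$) satisfy, for all times $\tau$, all elements $D^k$ and all $v,w\in P^N(D^k)$, the semi-discrete skew-symmetric ALE-DG formulation $$\Big(\tfrac{\partial m}{\partial\tau},v\Big)_{D^k}+\tfrac12\big\langle u^+\,G\cdot n,\,v\big\rangle_{\partial D^k}+\tfrac12\Big\{(d\,u,v)_{D^k}+(G\cdot\widehat\nabla u,v)_{D^k}-(u\,G,\widehat\nabla v)_{D^k}\Big\}=0,$$ $$\Big(\tfrac{\partial J}{\partial\tau},w\Big)_{D^k}+(d,w)_{D^k}=0,$$ where $u(\cdot,\tau)\in V_h$ is recovered from $m$ and $J$ by the standard DG method, i.e. $u$ is defined on each $D^k$ by $$(u,vJ)_{D^k}=(m,v)_{D^k}\qquad\text{for all } v\in P^N(D^k),$$ and is continuously differentiable in $\tau$. The boundary condition $u=0$ is imposed by setting the exterior trace $u^+=0$ on faces lying on $\partial\widehat\Omega$. Then the scheme is energy conservative in the sense that $$\frac12\frac{\partial}{\partial\tau}\|u\|_J^2=0,\qquad \|u\|_J^2:=\sum_k (u,uJ)_{D^k}.$$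
   Context: $\widehat\Omega\subset\mathbb R^2$ is a fixed polygonal reference domain with coordinates $(\xi_1,\xi_2)$ and gradient $\widehat\nabla$, partitioned by a conforming mesh into non-overlapping triangles $D^1,\dots,D^K$. $V_h$ is the space of functions on $\widehat\Omega$ whose restriction to each $D^k$ lies in $P^N(D^k)$, the polynomials of total degree at most $N$; no continuity across elements is required. $(\cdot,\cdot)_{D^k}$ and $\langle\cdot,\cdot\rangle_{\partial D^k}$ are the $L^2$ inner products on $D^k$ and $\partial D^k$; $n$ is the outward unit normal of $D^k$. On a face of $D^k$, $u$ is the trace from $D^k$ and $u^+$ is the trace from the neighbouring element. A moving physical domain is the image of $\widehat\Omega$ under a continuous, element-wise smooth, time-dependent map $x=X(\xi,\tau)$, $t=\tau$, with Jacobian determinant $\mathcal J>0$. The given time-dependent vector field $G=\mathcal J\,\widehat x_t$, where $\widehat x_t=(\partial\xi_1/\partial t,\partial\xi_2/\partial t)$, is smooth on each element up to its boundary, and $G\cdot n$ (for a fixed normal) takes the same value from both sides of every interior face. $d:=\widehat\nabla\cdot(\Pi_N G)$ is computed element by element, where $\Pi_N$ is the element-wise $L^2$ projection onto $P^N(D^k)$ (applied componentwise); thus $d\in V_h$, and it is the discrete version of $\widehat\nabla\cdot(J\widehat x_t)$. The evolved unknowns are $m$ (denoted "$uJ$", treated as one unknown) and the discrete Jacobian $J$; the scheme discretizes $\partial u/\partial t=0$ on the moving domain together with the geometric conservation law $\partial J/\partial\tau+\widehat\nabla\cdot(J\widehat x_t)=0$. *)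

theory Defs
  imports "HOL-Analysis.Analysis"
begin

type_synonym point = "real ^ 2"

section \<open>Smooth functions up to the boundary\<close>

text \<open>
  All derivatives are taken within \<open>S\<close>, so on a convex set with nonempty interior (the only kind of
  set used below: time intervals, closed triangles, products of these) they are unique, and
  \<open>smooth_on\<close> says that all partial derivatives exist and are continuous up to the boundary.
\<close>

primrec Ck_on ::
  "nat \<Rightarrow> ('a::real_normed_vector \<Rightarrow> 'b::real_normed_vector) \<Rightarrow> 'a set \<Rightarrow> bool" where
  "Ck_on 0 f S \<longleftrightarrow> continuous_on S f"
| "Ck_on (Suc n) f S \<longleftrightarrow>
     (\<exists>f'. (\<forall>x\<in>S. (f has_derivative f' x) (at x within S)) \<and> (\<forall>v. Ck_on n (\<lambda>x. f' x v) S))"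

definition smooth_on ::
  "('a::real_normed_vector \<Rightarrow> 'b::real_normed_vector) \<Rightarrow> 'a set \<Rightarrow> bool" where
  "smooth_on f S \<longleftrightarrow> (\<forall>n. Ck_on n f S)"

section \<open>Conforming triangulations\<close>

text \<open>
  The element \<open>D\<^sup>k\<close> is the closed triangle spanned by the three-point set \<open>V k\<close>, for \<open>k = 1, \<dots>, K\<close>;
  a face is given by its two end points.
\<close>

definition elem :: "(nat \<Rightarrow> point set) \<Rightarrow> nat \<Rightarrow> point set" where
  "elem V k = convex hull (V k)"

definition faces :: "(nat \<Rightarrow> point set) \<Rightarrow> nat \<Rightarrow> point set set" where
  "faces V k = {F. F \<subseteq> V k \<and> card F = 2}"

text \<open>
  \<open>\<Omega>\<close> is open and connected, and \<open>interior (closure \<Omega>) = \<Omega>\<close> excludes slits and punctures. It is polygonal because its closure is the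
  union of the triangles. The last clause says that two distinct triangles are disjoint, or meet
  exactly in a common vertex, or exactly in a common face; in particular they do not overlap.
\<close>

definition conforming_mesh :: "point set \<Rightarrow> nat \<Rightarrow> (nat \<Rightarrow> point set) \<Rightarrow> bool" where
  "conforming_mesh \<Omega> K V \<longleftrightarrow>
     open \<Omega> \<and> connected \<Omega> \<and> \<Omega> \<noteq> {} \<and> interior (closure \<Omega>) = \<Omega> \<and>
     closure \<Omega> = (\<Union>k\<in>{1..K}. elem V k) \<and>
     (\<forall>k\<in>{1..K}. card (V k) = 3 \<and> \<not> collinear (V k)) \<and>
     (\<forall>k\<in>{1..K}. \<forall>l\<in>{1..K}. k \<noteq> l \<longrightarrow>
        V k \<noteq> V l \<and> elem V k \<inter> elem V l = convex hull (V k \<inter> V l))"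

definition outward_normal :: "(nat \<Rightarrow> point set) \<Rightarrow> nat \<Rightarrow> point set \<Rightarrow> point" where
  "outward_normal V k F =
     (THE n. norm n = 1 \<and> (\<forall>p\<in>F. \<forall>q\<in>F. n \<bullet> (q - p) = 0) \<and>
             (\<forall>p\<in>F. \<forall>r\<in>V k - F. n \<bullet> (r - p) < 0))"

section \<open>Inner products\<close>

definition ip :: "point set \<Rightarrow> (point \<Rightarrow> 'a::real_inner) \<Rightarrow> (point \<Rightarrow> 'a) \<Rightarrow> real" where
  "ip D f g = (LINT \<xi>:D|lborel. f \<xi> \<bullet> g \<xi>)"

text \<open>
  Arc-length integral over the segment with end points \<open>F = {p, q}\<close>. The ordered pairs \<open>(p, q)\<close> and
  \<open>(q, p)\<close> give the same value (hence the factor \<open>1/2\<close>), and the pairs \<open>(p, p)\<close> contribute nothing.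
\<close>

definition face_integral :: "point set \<Rightarrow> (point \<Rightarrow> real) \<Rightarrow> real" where
  "face_integral F f =
     1/2 * (\<Sum>p\<in>F. \<Sum>q\<in>F. dist p q * (LINT s:{0..1}|lborel. f ((1 - s) *\<^sub>R p + s *\<^sub>R q)))"

text \<open>
  The integrand may depend on the face, as the normal and the exterior trace do.
\<close>

definition bd_ip ::
  "(nat \<Rightarrow> point set) \<Rightarrow> nat \<Rightarrow> (point set \<Rightarrow> point \<Rightarrow> real) \<Rightarrow> (point \<Rightarrow> real) \<Rightarrow> real" where
  "bd_ip V k f g = (\<Sum>F\<in>faces V k. face_integral F (\<lambda>\<xi>. f F \<xi> * g \<xi>))"

section \<open>Piecewise polynomials, gradient, divergence and projection\<close>

definition poly2 :: "nat \<Rightarrow> (nat \<Rightarrow> nat \<Rightarrow> real) \<Rightarrow> point \<Rightarrow> real" where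
  "poly2 N c \<xi> = (\<Sum>i\<le>N. \<Sum>j\<le>N - i. c i j * (\<xi> $ 1) ^ i * (\<xi> $ 2) ^ j)"

text \<open>
  A polynomial function on a triangle is identified with the polynomial function on the plane that
  extends it. A function in \<open>V\<^sub>h\<close> is two-valued on interior faces, so it is a family indexed by the
  elements: \<open>v k\<close> is its restriction to \<open>D\<^sup>k\<close>, including the trace on the faces of \<open>D\<^sup>k\<close>.
\<close>

definition PN :: "nat \<Rightarrow> (point \<Rightarrow> real) set" where
  "PN N = range (poly2 N)"

definition Vh :: "nat \<Rightarrow> nat \<Rightarrow> (nat \<Rightarrow> point \<Rightarrow> real) set" where
  "Vh N K = {v. \<forall>k\<in>{1..K}. v k \<in> PN N}"

text \<open>
  Continuously differentiable curves in the finite-dimensional space \<open>V\<^sub>h\<close>: on each element, the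
  coefficients with respect to the monomial basis are \<open>C\<^sup>1\<close> in time.
\<close>

definition C1_Vh :: "nat \<Rightarrow> nat \<Rightarrow> real set \<Rightarrow> (nat \<Rightarrow> real \<Rightarrow> point \<Rightarrow> real) \<Rightarrow> bool" where
  "C1_Vh N K T f \<longleftrightarrow>
     (\<forall>\<tau>\<in>T. (\<lambda>k. f k \<tau>) \<in> Vh N K) \<and>
     (\<forall>k\<in>{1..K}. \<exists>c. (\<forall>i j. Ck_on 1 (\<lambda>\<tau>. c \<tau> i j) T) \<and> (\<forall>\<tau>\<in>T. f k \<tau> = poly2 N (c \<tau>)))"

definition ddt :: "real set \<Rightarrow> (real \<Rightarrow> point \<Rightarrow> real) \<Rightarrow> real \<Rightarrow> point \<Rightarrow> real" where
  "ddt T f \<tau> \<xi> = vector_derivative (\<lambda>s. f s \<xi>) (at \<tau> within T)"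

definition grad :: "(point \<Rightarrow> real) \<Rightarrow> point \<Rightarrow> point" where
  "grad f \<xi> = (THE D. GDERIV f \<xi> :> D)"

definition dvg :: "(point \<Rightarrow> point) \<Rightarrow> point \<Rightarrow> real" where
  "dvg g \<xi> = (\<Sum>i\<in>UNIV. frechet_derivative g (at \<xi>) (axis i 1) $ i)"

definition L2_proj :: "nat \<Rightarrow> point set \<Rightarrow> (point \<Rightarrow> real) \<Rightarrow> point \<Rightarrow> real" where
  "L2_proj N D g = (THE p. p \<in> PN N \<and> (\<forall>v\<in>PN N. ip D p v = ip D g v))"

definition proj_dvg :: "nat \<Rightarrow> point set \<Rightarrow> (point \<Rightarrow> point) \<Rightarrow> point \<Rightarrow> real" where
  "proj_dvg N D g = dvg (\<lambda>\<xi>. \<chi> i. L2_proj N D (\<lambda>\<eta>. g \<eta> $ i) \<xi>)"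

text \<open>The trace \<open>u\<^sup>+\<close> on the face \<open>F\<close> of \<open>D\<^sup>k\<close>.\<close>

definition ext_trace ::
  "point set \<Rightarrow> nat \<Rightarrow> (nat \<Rightarrow> point set) \<Rightarrow> (nat \<Rightarrow> point \<Rightarrow> real) \<Rightarrow> nat \<Rightarrow> point set \<Rightarrow> point \<Rightarrow> real"
  where
  "ext_trace \<Omega> K V u k F \<xi> =
     (if convex hull F \<subseteq> frontier \<Omega> then 0
      else u (THE l. l \<in> {1..K} \<and> l \<noteq> k \<and> F \<in> faces V l) \<xi>)"

section \<open>The moving domain\<close>

definition jac_det :: "(point \<Rightarrow> point) \<Rightarrow> point set \<Rightarrow> point \<Rightarrow> real" where
  "jac_det f D \<xi> = det (matrix (frechet_derivative f (at \<xi> within D)))"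

definition moving_map ::
  "real set \<Rightarrow> point set \<Rightarrow> nat \<Rightarrow> (nat \<Rightarrow> point set) \<Rightarrow> (real \<Rightarrow> point \<Rightarrow> point) \<Rightarrow> bool" where
  "moving_map T \<Omega> K V X \<longleftrightarrow>
     continuous_on (T \<times> closure \<Omega>) (\<lambda>(\<tau>, \<xi>). X \<tau> \<xi>) \<and>
     (\<forall>k\<in>{1..K}. smooth_on (\<lambda>(\<tau>, \<xi>). X \<tau> \<xi>) (T \<times> elem V k)) \<and>
     (\<forall>k\<in>{1..K}. \<forall>\<tau>\<in>T. \<forall>\<xi>\<in>elem V k. jac_det (X \<tau>) (elem V k) \<xi> > 0)"

text \<open>
  \<open>w = \<partial>\<xi>/\<partial>t\<close> at the point \<open>\<xi>\<close> and time \<open>\<tau>\<close>: the physical point \<open>x = X \<tau> \<xi>\<close> is held fixed, and \<open>\<eta> s\<close> is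
  its reference coordinate at time \<open>s\<close> near \<open>\<tau>\<close>.
\<close>

definition ref_velocity ::
  "real set \<Rightarrow> point set \<Rightarrow> (real \<Rightarrow> point \<Rightarrow> point) \<Rightarrow> real \<Rightarrow> point \<Rightarrow> point \<Rightarrow> bool" where
  "ref_velocity T D X \<tau> \<xi> w \<longleftrightarrow>
     (\<exists>\<eta>. \<eta> \<tau> = \<xi> \<and>
          (\<forall>\<^sub>F s in at \<tau> within T. \<eta> s \<in> D \<and> X s (\<eta> s) = X \<tau> \<xi>) \<and>
          (\<eta> has_vector_derivative w) (at \<tau> within T))"

text \<open>
  \<open>G k \<tau>\<close> is the field on the closed element \<open>D\<^sup>k\<close>; it may be two-valued on interior faces, but its normal
  component is not. The formula for \<open>G\<close> is required in the interior of each element, which determines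
  \<open>G\<close> up to the boundary by continuity.
\<close>

definition ale_field ::
  "real set \<Rightarrow> nat \<Rightarrow> (nat \<Rightarrow> point set) \<Rightarrow> (real \<Rightarrow> point \<Rightarrow> point) \<Rightarrow>
   (nat \<Rightarrow> real \<Rightarrow> point \<Rightarrow> point) \<Rightarrow> bool" where
  "ale_field T K V X G \<longleftrightarrow>
     (\<forall>k\<in>{1..K}. \<forall>\<tau>\<in>T. smooth_on (G k \<tau>) (elem V k)) \<and>
     (\<forall>k\<in>{1..K}. \<forall>\<tau>\<in>T. \<forall>\<xi>\<in>interior (elem V k).
        \<exists>w. ref_velocity T (elem V k) X \<tau> \<xi> w \<and>
            G k \<tau> \<xi> = jac_det (X \<tau>) (elem V k) \<xi> *\<^sub>R w) \<and>
     (\<forall>k\<in>{1..K}. \<forall>l\<in>{1..K}. k \<noteq> l \<longrightarrow>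
        (\<forall>F\<in>faces V k \<inter> faces V l. \<forall>\<tau>\<in>T. \<forall>\<xi>\<in>convex hull F.
           G k \<tau> \<xi> \<bullet> outward_normal V k F = G l \<tau> \<xi> \<bullet> outward_normal V k F))"

definition norm_J_sq ::
  "nat \<Rightarrow> (nat \<Rightarrow> point set) \<Rightarrow> (nat \<Rightarrow> point \<Rightarrow> real) \<Rightarrow> (nat \<Rightarrow> point \<Rightarrow> real) \<Rightarrow> real" where
  "norm_J_sq K V J u = (\<Sum>k=1..K. ip (elem V k) (u k) (\<lambda>\<xi>. u k \<xi> * J k \<xi>))"

end

theory Submission
  imports Defs
begin

text \<open>
  Differentiating \<open>(u, v J) = (m, v)\<close> with \<open>v\<close> fixed, and then setting \<open>v = u\<close>, gives
  \<open>(u\<^sub>\<tau>, u J) + (u, u J\<^sub>\<tau>) = (m\<^sub>\<tau>, u)\<close>, so that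
  \<open>1/2 \<partial>\<^sub>\<tau> (u, u J) = (m\<^sub>\<tau>, u) - 1/2 (u\<^sup>2, J\<^sub>\<tau>)\<close>. Since \<open>J\<^sub>\<tau>\<close> and \<open>d\<close> are both polynomials of degree at most \<open>N\<close>, the
  discrete geometric conservation law holds pointwise, \<open>J\<^sub>\<tau> = - d\<close>. In the scheme tested with \<open>u\<close>, the two
  volume terms with \<open>G\<close> cancel by skew-symmetry, so on each element only the face terms
  \<open>- 1/2 \<langle>u\<^sup>+ G \<bullet> n, u\<rangle>\<close> survive. These are antisymmetric under exchanging the two sides of an interior face, and
  vanish on the boundary.
\<close>

section \<open>Elementwise inner products and orthogonal projection\<close>

lemma set_integrable_compact:
  fixes f :: "point \<Rightarrow> real"
  assumes "compact D" "continuous_on D f"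
  shows "set_integrable lborel D f"
  using borel_integrable_compact[OF assms] by (simp add: set_integrable_def)

lemma set_integral_linear_combination:
  fixes f :: "'i \<Rightarrow> point \<Rightarrow> real"
  assumes "compact D" "\<And>i. i \<in> I \<Longrightarrow> continuous_on D (f i)"
  shows "(LINT \<xi>:D|lborel. (\<Sum>i\<in>I. c i * f i \<xi>)) = (\<Sum>i\<in>I. c i * (LINT \<xi>:D|lborel. f i \<xi>))"
proof -
  have "integrable lborel (\<lambda>\<xi>. indicator D \<xi> *\<^sub>R (c i * f i \<xi>))" if "i \<in> I" for i
    by (rule borel_integrable_compact[OF assms(1)]) (intro continuous_intros assms(2) that)
  then show ?thesis
    by (simp add: set_lebesgue_integral_def sum_distrib_left mult.left_commute flip: integral_mult_right_zero)
qed

lemma ip_add_left: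
  fixes f g h :: "point \<Rightarrow> real"
  assumes "compact D" "continuous_on D f" "continuous_on D g" "continuous_on D h"
  shows "ip D (\<lambda>\<xi>. f \<xi> + g \<xi>) h = ip D f h + ip D g h"
  unfolding ip_def inner_real_def distrib_right
  by (rule set_integral_add) (intro set_integrable_compact continuous_intros assms)+

lemma ip_scale_left:
  fixes f g :: "point \<Rightarrow> real"
  shows "ip D (\<lambda>\<xi>. c * f \<xi>) g = c * ip D f g"
  by (simp add: ip_def mult.assoc)

lemma ip_diff_left:
  fixes f g h :: "point \<Rightarrow> real"
  assumes "compact D" "continuous_on D f" "continuous_on D g" "continuous_on D h"
  shows "ip D (\<lambda>\<xi>. f \<xi> - g \<xi>) h = ip D f h - ip D g h"
  unfolding ip_def inner_real_def left_diff_distrib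
  by (rule set_integral_diff) (intro set_integrable_compact continuous_intros assms)+

lemma ip_commute: "ip D f g = ip D g f"
  by (simp add: ip_def inner_commute)

lemma ip_sum_left:
  fixes f :: "'i \<Rightarrow> point \<Rightarrow> real"
  assumes "compact D" "\<And>i. i \<in> I \<Longrightarrow> continuous_on D (f i)" "continuous_on D g"
  shows "ip D (\<lambda>\<xi>. \<Sum>i\<in>I. c i * f i \<xi>) g = (\<Sum>i\<in>I. c i * ip D (f i) g)"
proof -
  have "ip D (\<lambda>\<xi>. \<Sum>i\<in>I. c i * f i \<xi>) g = (LINT \<xi>:D|lborel. (\<Sum>i\<in>I. c i * (f i \<xi> * g \<xi>)))"
    by (simp add: ip_def sum_distrib_right mult.assoc)
  also have "\<dots> = (\<Sum>i\<in>I. c i * ip D (f i) g)"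
    unfolding ip_def inner_real_def
    by (rule set_integral_linear_combination) (intro continuous_intros assms | assumption)+
  finally show ?thesis .
qed

text \<open>The integrand is nonnegative. On a general compact set, which may have empty interior,
  its zero integral yields vanishing almost everywhere only.\<close>

lemma ip_self_eq_0:
  fixes z :: "point \<Rightarrow> real"
  assumes "compact D" "continuous_on D z" "ip D z z = 0"
  shows "AE \<xi> in lborel. \<xi> \<in> D \<longrightarrow> z \<xi> = 0"
proof -
  have int: "integrable lborel (\<lambda>\<xi>. indicator D \<xi> *\<^sub>R (z \<xi> * z \<xi>))"
    by (rule borel_integrable_compact) (intro continuous_intros assms)+
  have "AE \<xi> in lborel. indicator D \<xi> *\<^sub>R (z \<xi> * z \<xi>) = 0"
    using assms(3) integral_nonneg_eq_0_iff_AE[OF int]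
    by (simp add: ip_def set_lebesgue_integral_def)
  then show ?thesis
    by eventually_elim (auto simp: indicator_def split: if_splits)
qed

text \<open>The degenerate case of Cauchy-Schwarz; it covers the zero denominator in the
  Gram-Schmidt step below.\<close>

lemma ip_eq_0_if_ip_self_eq_0:
  fixes z g :: "point \<Rightarrow> real"
  assumes "compact D" "continuous_on D z" "ip D z z = 0"
  shows "ip D g z = 0"
proof -
  have "AE \<xi> in lborel. indicator D \<xi> *\<^sub>R (g \<xi> * z \<xi>) = 0"
    using ip_self_eq_0[OF assms] by eventually_elim (auto simp: indicator_def)
  then show ?thesis
    by (simp add: ip_def set_lebesgue_integral_def integral_eq_zero_AE)
qed

text \<open>
  Gram--Schmidt without a linear independence assumption: if \<open>e k\<close> depends on its predecessors, then
  \<open>ip D z z = 0\<close> below and \<open>t = 0\<close> by the convention on division by zero.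
\<close>

lemma orthogonal_projection_exists:
  fixes e :: "'i \<Rightarrow> point \<Rightarrow> real" and g :: "point \<Rightarrow> real"
  assumes D: "compact D" and fin: "finite I"
    and e: "\<And>i. i \<in> I \<Longrightarrow> continuous_on D (e i)" and g: "continuous_on D g"
  shows "\<exists>c. \<forall>i\<in>I. ip D (\<lambda>\<xi>. g \<xi> - (\<Sum>j\<in>I. c j * e j \<xi>)) (e i) = 0"
  using fin e g
proof (induction I arbitrary: g rule: finite_induct)
  case empty
  then show ?case by simp
next
  case (insert k I)
  obtain x where x: "\<And>i. i \<in> I \<Longrightarrow> ip D (\<lambda>\<xi>. g \<xi> - (\<Sum>j\<in>I. x j * e j \<xi>)) (e i) = 0"
    using insert.IH[of g] insert.prems by auto
  obtain y where y: "\<And>i. i \<in> I \<Longrightarrow> ip D (\<lambda>\<xi>. e k \<xi> - (\<Sum>j\<in>I. y j * e j \<xi>)) (e i) = 0"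
    using insert.IH[of "e k"] insert.prems by auto
  \<comment> \<open>\<open>z\<close> is the part of \<open>e k\<close> orthogonal to the old
    functions and \<open>r\<close> the residual of \<open>g\<close> against them; \<open>c\<close>
    collects the coefficients for which \<open>r - t * z\<close> is the new residual.\<close>
  define z where "z = (\<lambda>\<xi>. e k \<xi> - (\<Sum>j\<in>I. y j * e j \<xi>))"
  define r where "r = (\<lambda>\<xi>. g \<xi> - (\<Sum>j\<in>I. x j * e j \<xi>))"
  define t where "t = ip D r z / ip D z z"
  define c where "c = (\<lambda>j. if j = k then t else x j - t * y j)"
  have e': "continuous_on D (e j)" if "j \<in> insert k I" for j
    using insert.prems(1)[OF that] .
  have cz: "continuous_on D z" and cr: "continuous_on D r"
    unfolding z_def r_def by (intro continuous_intros insert.prems e' | simp)+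
  define w where "w = (\<lambda>\<xi>. r \<xi> - t * z \<xi>)"
  have cw: "continuous_on D w"
    unfolding w_def by (intro continuous_intros cz cr)
  have "(\<Sum>j\<in>I. c j * e j \<xi>) = (\<Sum>j\<in>I. x j * e j \<xi>) - t * (\<Sum>j\<in>I. y j * e j \<xi>)" for \<xi>
  proof -
    have "(\<Sum>j\<in>I. c j * e j \<xi>) = (\<Sum>j\<in>I. x j * e j \<xi> - t * (y j * e j \<xi>))"
      by (rule sum.cong) (use insert.hyps in \<open>auto simp: c_def algebra_simps\<close>)
    then show ?thesis by (simp add: sum_subtractf sum_distrib_left)
  qed
  then have w_eq: "(\<lambda>\<xi>. g \<xi> - (\<Sum>j\<in>insert k I. c j * e j \<xi>)) = w"
    using insert.hyps by (auto simp: w_def r_def z_def c_def algebra_simps)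
  have w_inner: "ip D w f = ip D r f - t * ip D z f" if "continuous_on D f" for f
    unfolding w_def using ip_diff_left[OF D cr _ that, of "\<lambda>\<xi>. t * z \<xi>"] cz
    by (simp add: ip_scale_left continuous_on_mult_left)
  have wI: "ip D w (e i) = 0" if "i \<in> I" for i
    using that x[OF that] y[OF that] w_inner[of "e i"] e'[of i] by (simp add: r_def z_def)
  \<comment> \<open>For nonzero \<open>ip D z z\<close> this is the choice of \<open>t\<close>;
    otherwise \<open>ip D r z\<close> vanishes as well.\<close>
  have "ip D w z = 0"
    using w_inner[OF cz] ip_eq_0_if_ip_self_eq_0[OF D cz, of r] by (auto simp: t_def)
  moreover have "ip D (\<lambda>\<xi>. \<Sum>j\<in>I. y j * e j \<xi>) w = 0"
    using ip_sum_left[OF D _ cw, of I e y] e' wI by (simp add: ip_commute)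
  moreover have "ip D (e k) w = ip D z w + ip D (\<lambda>\<xi>. \<Sum>j\<in>I. y j * e j \<xi>) w"
  proof -
    have "ip D (\<lambda>\<xi>. z \<xi> + (\<Sum>j\<in>I. y j * e j \<xi>)) w = ip D z w + ip D (\<lambda>\<xi>. \<Sum>j\<in>I. y j * e j \<xi>) w"
      by (rule ip_add_left[OF D cz _ cw]) (intro continuous_intros e' | simp)+
    then show ?thesis by (simp add: z_def)
  qed
  ultimately have "ip D w (e k) = 0" by (simp add: ip_commute)
  then show ?case
    using wI w_eq by (intro exI[of _ c]) auto
qed

section \<open>Polynomials of bounded degree\<close>

text \<open>Flattens the double sum of \<open>poly2\<close> into one sum over a finite set, the form
  to which the lemmas on linear combinations apply.\<close>

definition mono_idx :: "nat \<Rightarrow> (nat \<times> nat) set" where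
  "mono_idx N = (SIGMA i:{..N}. {..N - i})"

definition monom2 :: "nat \<times> nat \<Rightarrow> point \<Rightarrow> real" where
  "monom2 p \<xi> = (\<xi> $ 1) ^ fst p * (\<xi> $ 2) ^ snd p"

lemma finite_mono_idx [simp]: "finite (mono_idx N)"
  by (simp add: mono_idx_def)

lemma continuous_on_monom2 [continuous_intros]: "continuous_on D (monom2 p)"
  unfolding monom2_def by (intro continuous_intros)

lemma poly2_eq_sum: "poly2 N c = (\<lambda>\<xi>. \<Sum>p\<in>mono_idx N. case_prod c p * monom2 p \<xi>)"
proof
  fix \<xi>
  have "poly2 N c \<xi> = (\<Sum>i\<le>N. \<Sum>j\<le>N - i. c i j * monom2 (i, j) \<xi>)"
    by (simp add: poly2_def monom2_def mult.assoc)
  also have "\<dots> = (\<Sum>p\<in>mono_idx N. case_prod c p * monom2 p \<xi>)"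
    unfolding mono_idx_def by (subst sum.Sigma) (auto intro: sum.cong)
  finally show "poly2 N c \<xi> = (\<Sum>p\<in>mono_idx N. case_prod c p * monom2 p \<xi>)" .
qed

lemma PN_iff: "f \<in> PN N \<longleftrightarrow> (\<exists>c. f = (\<lambda>\<xi>. \<Sum>p\<in>mono_idx N. c p * monom2 p \<xi>))"
proof
  show "f \<in> PN N \<Longrightarrow> \<exists>c. f = (\<lambda>\<xi>. \<Sum>p\<in>mono_idx N. c p * monom2 p \<xi>)"
    unfolding PN_def poly2_eq_sum by blast
next
  assume "\<exists>c. f = (\<lambda>\<xi>. \<Sum>p\<in>mono_idx N. c p * monom2 p \<xi>)"
  then obtain c where c: "f = (\<lambda>\<xi>. \<Sum>p\<in>mono_idx N. c p * monom2 p \<xi>)" by blast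
  have "f = poly2 N (curry c)"
    unfolding poly2_eq_sum c by simp
  then show "f \<in> PN N" by (simp add: PN_def)
qed

lemma continuous_on_PN: "f \<in> PN N \<Longrightarrow> continuous_on D f"
  by (auto simp: PN_iff intro!: continuous_intros)

lemma PN_add: "f \<in> PN N \<Longrightarrow> g \<in> PN N \<Longrightarrow> (\<lambda>\<xi>. f \<xi> + g \<xi>) \<in> PN N"
  unfolding PN_iff by (elim exE, rule exI[of _ "\<lambda>p. c p + d p" for c d])
    (simp add: distrib_right sum.distrib)

lemma PN_scale: "f \<in> PN N \<Longrightarrow> (\<lambda>\<xi>. a * f \<xi>) \<in> PN N"
  unfolding PN_iff by (elim exE, rule exI[of _ "\<lambda>p. a * c p" for c])
    (simp add: sum_distrib_left mult.assoc)

lemma PN_diff: "f \<in> PN N \<Longrightarrow> g \<in> PN N \<Longrightarrow> (\<lambda>\<xi>. f \<xi> - g \<xi>) \<in> PN N"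
  using PN_add[OF _ PN_scale[of g N "-1"]] by simp

lemma PN_zero: "(\<lambda>\<xi>. 0) \<in> PN N"
  unfolding PN_iff by (rule exI[of _ "\<lambda>_. 0"]) simp

lemma PN_sum: "(\<And>i. i \<in> I \<Longrightarrow> f i \<in> PN N) \<Longrightarrow> (\<lambda>\<xi>. \<Sum>i\<in>I. f i \<xi>) \<in> PN N"
  by (induction I rule: infinite_finite_induct) (simp_all add: PN_zero PN_add)

lemma monom2_in_PN: "p \<in> mono_idx N \<Longrightarrow> monom2 p \<in> PN N"
  unfolding PN_iff by (rule exI[of _ "\<lambda>q. if q = p then 1 else 0"])
    (simp add: sum.delta if_distrib[of "\<lambda>a. a * _"] fun_eq_iff cong: if_cong)

lemma PN_one: "(\<lambda>\<xi>. 1) \<in> PN N"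
  using monom2_in_PN[of "(0, 0)" N] by (simp add: mono_idx_def monom2_def[abs_def])

section \<open>Definiteness of the inner product on polynomials\<close>

lemma PN_along_line:
  assumes "f \<in> PN N"
  shows "\<exists>P. \<forall>t. f (x + t *\<^sub>R y) = poly P t"
proof -
  obtain c where c: "f = (\<lambda>\<xi>. \<Sum>p\<in>mono_idx N. c p * monom2 p \<xi>)"
    using assms PN_iff by blast
  have "f (x + t *\<^sub>R y) =
      poly (\<Sum>p\<in>mono_idx N. smult (c p) ([:x $ 1, y $ 1:] ^ fst p * [:x $ 2, y $ 2:] ^ snd p)) t" for t
    by (simp add: c poly_sum monom2_def)
  then show ?thesis by blast
qed

text \<open>On the line from a point of \<open>U\<close> to any \<open>\<eta>\<close>,
  \<open>f\<close> is a polynomial in one variable with infinitely many roots near \<open>0\<close>,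
  hence it vanishes at parameter \<open>1\<close> too.\<close>

lemma PN_eq_0_if_vanishing_on_open:
  assumes f: "f \<in> PN N" and U: "open U" "U \<noteq> {}" and 0: "\<And>\<xi>. \<xi> \<in> U \<Longrightarrow> f \<xi> = 0"
  shows "f = (\<lambda>_. 0)"
proof
  fix \<eta>
  obtain x where "x \<in> U" using U by blast
  obtain P where P: "\<And>t. f (x + t *\<^sub>R (\<eta> - x)) = poly P t"
    using PN_along_line[OF f] by metis
  have "((\<lambda>t::real. x + t *\<^sub>R (\<eta> - x)) \<longlongrightarrow> x + 0 *\<^sub>R (\<eta> - x)) (at_right 0)"
    by (intro tendsto_intros)
  then have "\<forall>\<^sub>F t in at_right 0. x + t *\<^sub>R (\<eta> - x) \<in> U"
    using U(1) \<open>x \<in> U\<close> topological_tendstoD by fastforce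
  then obtain b :: real where b: "b > 0" "\<And>t. 0 < t \<Longrightarrow> t < b \<Longrightarrow> x + t *\<^sub>R (\<eta> - x) \<in> U"
    unfolding eventually_at_right_field by blast
  have "{0<..<b} \<subseteq> {t. poly P t = 0}"
    using b 0 P by (metis (mono_tags, lifting) greaterThanLessThan_iff mem_Collect_eq subsetI)
  then have "P = 0"
    using b(1) poly_roots_finite[of P] by (meson finite_subset infinite_Ioo)
  then show "f \<eta> = 0" using P[of 1] by simp
qed

text \<open>The points of the interior of \<open>D\<close> where \<open>f\<close> is nonzero form an
  open negligible set, so there are none; vanishing then spreads to the whole plane.\<close>

lemma PN_definite:
  assumes f: "f \<in> PN N" and D: "compact D" "interior D \<noteq> {}" and 0: "ip D f f = 0"
  shows "f = (\<lambda>_. 0)"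
proof (rule PN_eq_0_if_vanishing_on_open[OF f open_interior D(2)])
  fix \<xi> assume \<xi>: "\<xi> \<in> interior D"
  define U where "U = interior D \<inter> {\<xi>. f \<xi> \<noteq> 0}"
  have "open U"
    unfolding U_def
    by (intro open_Int open_interior open_Collect_neq continuous_on_PN[OF f] continuous_intros)
  moreover have "negligible U"
  proof -
    have "AE \<xi> in lebesgue. \<xi> \<notin> U"
      using ip_self_eq_0[OF D(1) continuous_on_PN[OF f] 0] interior_subset[of D]
      by (intro AE_completion, elim eventually_mono) (auto simp: U_def)
    moreover have "U \<in> sets lebesgue" using \<open>open U\<close> by simp
    ultimately show ?thesis
      by (simp add: negligible_iff_null_sets AE_iff_null_sets)
  qed
  ultimately show "f \<xi> = 0"
    using open_not_negligible \<xi> by (auto simp: U_def)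
qed

text \<open>\<open>L2_proj\<close> is a definite description, so membership takes both existence,
  from orthogonality to the monomials, and uniqueness, from definiteness on
  \<open>PN N\<close>.\<close>

lemma L2_proj_in_PN:
  assumes D: "compact D" "interior D \<noteq> {}" and g: "continuous_on D g"
  shows "L2_proj N D g \<in> PN N"
proof -
  obtain c where c: "\<And>p. p \<in> mono_idx N \<Longrightarrow>
      ip D (\<lambda>\<xi>. g \<xi> - (\<Sum>q\<in>mono_idx N. c q * monom2 q \<xi>)) (monom2 p) = 0"
    using orthogonal_projection_exists[OF D(1) finite_mono_idx continuous_on_monom2 g, of N "\<lambda>p. p"] by blast
  define P where "P = (\<lambda>\<xi>. \<Sum>q\<in>mono_idx N. c q * monom2 q \<xi>)"
  have P: "P \<in> PN N" by (auto simp: PN_iff P_def)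
  note cont = continuous_on_PN
  have eq: "ip D P v = ip D g v" if v: "v \<in> PN N" for v
  proof -
    obtain a where a: "v = (\<lambda>\<xi>. \<Sum>p\<in>mono_idx N. a p * monom2 p \<xi>)"
      using v PN_iff by blast
    have cr: "continuous_on D (\<lambda>\<xi>. g \<xi> - P \<xi>)"
      by (intro continuous_intros g cont[OF P])
    have "ip D v (\<lambda>\<xi>. g \<xi> - P \<xi>) = (\<Sum>p\<in>mono_idx N. a p * ip D (monom2 p) (\<lambda>\<xi>. g \<xi> - P \<xi>))"
      unfolding a by (rule ip_sum_left[OF D(1) continuous_on_monom2 cr])
    also have "\<dots> = 0"
      using c by (simp add: ip_commute[of D "monom2 _"] P_def)
    finally show ?thesis
      using ip_diff_left[OF D(1) g cont[OF P] cont[OF v]] by (simp add: ip_commute[of D v])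
  qed
  have "\<exists>!p. p \<in> PN N \<and> (\<forall>v\<in>PN N. ip D p v = ip D g v)"
  proof (rule ex1I[of _ P])
    show "P \<in> PN N \<and> (\<forall>v\<in>PN N. ip D P v = ip D g v)" using P eq by blast
  next
    fix Q assume Q: "Q \<in> PN N \<and> (\<forall>v\<in>PN N. ip D Q v = ip D g v)"
    then have QP: "(\<lambda>\<xi>. Q \<xi> - P \<xi>) \<in> PN N" using P PN_diff by blast
    have "ip D (\<lambda>\<xi>. Q \<xi> - P \<xi>) (\<lambda>\<xi>. Q \<xi> - P \<xi>) = 0"
      using ip_diff_left[OF D(1) cont cont cont, of Q N P N _ N] Q P eq QP by simp
    then have "(\<lambda>\<xi>. Q \<xi> - P \<xi>) = (\<lambda>_. 0)"
      using PN_definite[OF QP D] by blast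
    then show "Q = P" by (simp add: fun_eq_iff)
  qed
  from theI'[OF this] show ?thesis
    unfolding L2_proj_def by blast
qed

section \<open>Derivatives and divergence of polynomials\<close>

lemma monom2_has_derivative:
  "(monom2 (i, j) has_derivative
     (\<lambda>h. real i * h $ 1 * monom2 (i - 1, j) \<xi> + real j * h $ 2 * monom2 (i, j - 1) \<xi>)) (at \<xi>)"
proof -
  have nth: "((\<lambda>\<xi>::point. \<xi> $ l) has_derivative (\<lambda>h. h $ l)) (at \<xi>)" for l
    by (rule bounded_linear.has_derivative[OF bounded_linear_vec_nth has_derivative_ident])
  show ?thesis
    unfolding monom2_def fst_conv snd_conv
    by (rule has_derivative_eq_rhs[OF has_derivative_mult[OF has_derivative_power[OF nth]
          has_derivative_power[OF nth]]]) (simp add: fun_eq_iff)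
qed

lemma PN_partial_derivatives:
  assumes "f \<in> PN N"
  shows "\<exists>f1\<in>PN N. \<exists>f2\<in>PN N. \<forall>\<xi>. (f has_derivative (\<lambda>h. h $ 1 * f1 \<xi> + h $ 2 * f2 \<xi>)) (at \<xi>)"
proof -
  obtain c where c: "f = (\<lambda>\<xi>. \<Sum>p\<in>mono_idx N. c p * monom2 p \<xi>)"
    using assms PN_iff by blast
  \<comment> \<open>For exponent \<open>0\<close> the truncated subtraction keeps the index in
    \<open>mono_idx N\<close>, and the factor \<open>real 0\<close> removes the term.\<close>
  define f1 where "f1 = (\<lambda>\<xi>. \<Sum>p\<in>mono_idx N. c p * real (fst p) * monom2 (fst p - 1, snd p) \<xi>)"
  define f2 where "f2 = (\<lambda>\<xi>. \<Sum>p\<in>mono_idx N. c p * real (snd p) * monom2 (fst p, snd p - 1) \<xi>)"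
  have "f1 \<in> PN N" "f2 \<in> PN N"
    unfolding f1_def f2_def
    by (intro PN_sum PN_scale monom2_in_PN; auto simp: mono_idx_def)+
  moreover have "(f has_derivative (\<lambda>h. h $ 1 * f1 \<xi> + h $ 2 * f2 \<xi>)) (at \<xi>)" for \<xi>
  proof -
    have "(f has_derivative (\<lambda>h. \<Sum>p\<in>mono_idx N. c p *
        (real (fst p) * h $ 1 * monom2 (fst p - 1, snd p) \<xi>
          + real (snd p) * h $ 2 * monom2 (fst p, snd p - 1) \<xi>))) (at \<xi>)"
      unfolding c using monom2_has_derivative[of "fst p" "snd p" \<xi> for p]
      by (intro has_derivative_sum has_derivative_mult_right) simp
    then show ?thesis
      by (simp add: f1_def f2_def sum_distrib_left sum.distrib[symmetric] algebra_simps)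
  qed
  ultimately show ?thesis by blast
qed

lemma PN_frechet_derivative:
  assumes "f \<in> PN N"
  shows "(\<lambda>\<xi>. frechet_derivative f (at \<xi>) h) \<in> PN N"
proof -
  obtain f1 f2 where f: "f1 \<in> PN N" "f2 \<in> PN N"
    and der: "\<And>\<xi>. (f has_derivative (\<lambda>h. h $ 1 * f1 \<xi> + h $ 2 * f2 \<xi>)) (at \<xi>)"
    using PN_partial_derivatives[OF assms] by blast
  have "frechet_derivative f (at \<xi>) h = h $ 1 * f1 \<xi> + h $ 2 * f2 \<xi>" for \<xi>
    by (rule fun_cong[OF frechet_derivative_at[OF der, symmetric]])
  then show ?thesis using PN_add PN_scale f by simp
qed

lemma dvg_in_PN:
  assumes "\<And>i. p i \<in> PN N"
  shows "dvg (\<lambda>\<xi>. \<chi> i. p i \<xi>) \<in> PN N"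
proof -
  have der: "(p i has_derivative frechet_derivative (p i) (at \<xi>)) (at \<xi>)" for i \<xi>
    using PN_partial_derivatives[OF assms, of i] by (meson differentiableI frechet_derivative_works)
  have "((\<lambda>\<xi>. \<chi> i. p i \<xi>) has_derivative (\<lambda>h. \<chi> i. frechet_derivative (p i) (at \<xi>) h)) (at \<xi>)"
    for \<xi>
  proof (subst has_derivative_componentwise_within, rule ballI)
    fix b :: point assume "b \<in> Basis"
    then obtain i where b: "b = axis i 1" unfolding Basis_vec_def by auto
    show "((\<lambda>\<xi>. (\<chi> i. p i \<xi>) \<bullet> b) has_derivative
        (\<lambda>h. (\<chi> i. frechet_derivative (p i) (at \<xi>) h) \<bullet> b)) (at \<xi>)"
      using der[of i \<xi>] by (simp add: b inner_axis)
  qed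
  then have "frechet_derivative (\<lambda>\<xi>. \<chi> i. p i \<xi>) (at \<xi>) = (\<lambda>h. \<chi> i. frechet_derivative (p i) (at \<xi>) h)"
    for \<xi>
    by (rule frechet_derivative_at[symmetric])
  then have "dvg (\<lambda>\<xi>. \<chi> i. p i \<xi>) = (\<lambda>\<xi>. \<Sum>i\<in>UNIV. frechet_derivative (p i) (at \<xi>) (axis i 1))"
    by (simp add: fun_eq_iff dvg_def)
  then show ?thesis
    using PN_sum[of UNIV "\<lambda>i \<xi>. frechet_derivative (p i) (at \<xi>) (axis i 1)"]
      PN_frechet_derivative[OF assms] by simp
qed

text \<open>This places the discrete divergence \<open>d\<close> in \<open>PN N\<close>, the reason
  why the geometric conservation law can later be made pointwise.\<close>

lemma proj_dvg_in_PN: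
  assumes "compact D" "interior D \<noteq> {}" "continuous_on D g"
  shows "proj_dvg N D g \<in> PN N"
  unfolding proj_dvg_def[abs_def]
  by (rule dvg_in_PN) (intro L2_proj_in_PN assms continuous_intros)

section \<open>Differentiating in time\<close>

text \<open>Differentiability at a single time is expressed through coefficients, so that
  differentiating an inner product in time concerns finite sums rather than an exchange of
  derivative and integral.\<close>

definition PN_curve ::
  "nat \<Rightarrow> real set \<Rightarrow> real \<Rightarrow> (real \<Rightarrow> point \<Rightarrow> real) \<Rightarrow> (point \<Rightarrow> real) \<Rightarrow> bool" where
  "PN_curve N T \<tau> f f' \<longleftrightarrow>
     (\<exists>a a'. (\<forall>s\<in>T. f s = (\<lambda>\<xi>. \<Sum>p\<in>mono_idx N. a s p * monom2 p \<xi>)) \<and>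
             f' = (\<lambda>\<xi>. \<Sum>p\<in>mono_idx N. a' p * monom2 p \<xi>) \<and>
             (\<forall>p. ((\<lambda>s. a s p) has_real_derivative a' p) (at \<tau> within T)))"

lemma PN_curve_in_PN:
  assumes "PN_curve N T \<tau> f f'"
  shows "s \<in> T \<Longrightarrow> f s \<in> PN N" "f' \<in> PN N"
  using assms unfolding PN_curve_def PN_iff by blast+

lemma PN_curve_const:
  assumes "v \<in> PN N"
  shows "PN_curve N T \<tau> (\<lambda>_. v) (\<lambda>_. 0)"
proof -
  obtain c where c: "v = (\<lambda>\<xi>. \<Sum>p\<in>mono_idx N. c p * monom2 p \<xi>)"
    using assms PN_iff by blast
  show ?thesis
    unfolding PN_curve_def c by (rule exI[of _ "\<lambda>_. c"], rule exI[of _ "\<lambda>_. 0"]) simp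
qed

text \<open>The triple integral is a trilinear form; in the monomial basis its entries are fixed by
  \<open>D\<close>, and time will enter through the coefficients only.\<close>

lemma ip_sum_sum_sum:
  assumes D: "compact D"
  shows "ip D (\<lambda>\<xi>. \<Sum>p\<in>mono_idx N. a p * monom2 p \<xi>)
      (\<lambda>\<xi>. (\<Sum>q\<in>mono_idx N. b q * monom2 q \<xi>) * (\<Sum>r\<in>mono_idx N. c r * monom2 r \<xi>)) =
    (\<Sum>p\<in>mono_idx N. \<Sum>q\<in>mono_idx N. \<Sum>r\<in>mono_idx N.
      a p * b q * c r * ip D (monom2 p) (\<lambda>\<xi>. monom2 q \<xi> * monom2 r \<xi>))"
proof -
  let ?P = "\<lambda>c \<xi>. \<Sum>p\<in>mono_idx N. c p * monom2 p \<xi>"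
  \<comment> \<open>The integrand is symmetric in its three factors, so rotating them lets linearity
    in the first slot expand all three.\<close>
  have rot: "ip D f (\<lambda>\<xi>. g \<xi> * h \<xi>) = ip D g (\<lambda>\<xi>. h \<xi> * f \<xi>)" for f g h :: "point \<Rightarrow> real"
    by (simp add: ip_def mult_ac)
  have cP: "continuous_on D (?P c)" for c
    by (intro continuous_intros)
  have lin: "ip D (?P c) (\<lambda>\<xi>. g \<xi> * h \<xi>) = (\<Sum>p\<in>mono_idx N. c p * ip D g (\<lambda>\<xi>. h \<xi> * monom2 p \<xi>))"
    if "continuous_on D g" "continuous_on D h" for c g h
    unfolding rot[of g h] rot[of h]
    by (rule ip_sum_left[OF D]) (intro continuous_intros that)+
  have "ip D (?P a) (\<lambda>\<xi>. ?P b \<xi> * ?P c \<xi>) =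
      (\<Sum>p\<in>mono_idx N. a p * ip D (?P b) (\<lambda>\<xi>. ?P c \<xi> * monom2 p \<xi>))"
    by (rule lin[OF cP cP])
  also have "\<dots> = (\<Sum>p\<in>mono_idx N. a p *
      (\<Sum>q\<in>mono_idx N. b q * ip D (?P c) (\<lambda>\<xi>. monom2 p \<xi> * monom2 q \<xi>)))"
    by (intro sum.cong refl arg_cong[of _ _ "(*) _"] lin[OF cP continuous_on_monom2])
  also have "\<dots> = (\<Sum>p\<in>mono_idx N. a p * (\<Sum>q\<in>mono_idx N. b q *
      (\<Sum>r\<in>mono_idx N. c r * ip D (monom2 p) (\<lambda>\<xi>. monom2 q \<xi> * monom2 r \<xi>))))"
    by (intro sum.cong refl arg_cong[of _ _ "(*) _"] lin continuous_on_monom2)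
  finally show ?thesis
    by (simp add: sum_distrib_left mult.assoc)
qed

lemma ip_triple_has_derivative:
  assumes D: "compact D" and \<tau>: "\<tau> \<in> T"
    and f: "PN_curve N T \<tau> f f'" and g: "PN_curve N T \<tau> g g'" and h: "PN_curve N T \<tau> h h'"
  shows "((\<lambda>s. ip D (f s) (\<lambda>\<xi>. g s \<xi> * h s \<xi>)) has_real_derivative
      ip D f' (\<lambda>\<xi>. g \<tau> \<xi> * h \<tau> \<xi>) + ip D (f \<tau>) (\<lambda>\<xi>. g' \<xi> * h \<tau> \<xi>)
        + ip D (f \<tau>) (\<lambda>\<xi>. g \<tau> \<xi> * h' \<xi>)) (at \<tau> within T)"
proof -
  let ?P = "\<lambda>c \<xi>. \<Sum>p\<in>mono_idx N. c p * monom2 p \<xi>"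
  let ?M = "\<lambda>p q r. ip D (monom2 p) (\<lambda>\<xi>. monom2 q \<xi> * monom2 r \<xi>)"
  let ?S = "\<lambda>a b c. \<Sum>p\<in>mono_idx N. \<Sum>q\<in>mono_idx N. \<Sum>r\<in>mono_idx N. a p * b q * c r * ?M p q r"
  obtain a a' where a: "\<And>s. s \<in> T \<Longrightarrow> f s = ?P (a s)" "f' = ?P a'"
    and da: "\<And>p. ((\<lambda>s. a s p) has_real_derivative a' p) (at \<tau> within T)"
    using f unfolding PN_curve_def by blast
  obtain b b' where b: "\<And>s. s \<in> T \<Longrightarrow> g s = ?P (b s)" "g' = ?P b'"
    and db: "\<And>p. ((\<lambda>s. b s p) has_real_derivative b' p) (at \<tau> within T)"
    using g unfolding PN_curve_def by blast
  obtain c c' where c: "\<And>s. s \<in> T \<Longrightarrow> h s = ?P (c s)" "h' = ?P c'"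
    and dc: "\<And>p. ((\<lambda>s. c s p) has_real_derivative c' p) (at \<tau> within T)"
    using h unfolding PN_curve_def by blast
  have "((\<lambda>s. a s p * b s q * c s r * M) has_real_derivative
      (a' p * b \<tau> q * c \<tau> r * M + a \<tau> p * b' q * c \<tau> r * M + a \<tau> p * b \<tau> q * c' r * M))
      (at \<tau> within T)" for p q r M
    by (rule derivative_eq_intros da db dc refl)+ (simp add: algebra_simps)
  then have "((\<lambda>s. ?S (a s) (b s) (c s)) has_real_derivative
      (\<Sum>p\<in>mono_idx N. \<Sum>q\<in>mono_idx N. \<Sum>r\<in>mono_idx N. a' p * b \<tau> q * c \<tau> r * ?M p q r
        + a \<tau> p * b' q * c \<tau> r * ?M p q r + a \<tau> p * b \<tau> q * c' r * ?M p q r)) (at \<tau> within T)"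
    by (intro DERIV_sum)
  then have "((\<lambda>s. ?S (a s) (b s) (c s)) has_real_derivative
      ?S a' (b \<tau>) (c \<tau>) + ?S (a \<tau>) b' (c \<tau>) + ?S (a \<tau>) (b \<tau>) c') (at \<tau> within T)"
    by (simp add: sum.distrib)
  then have "((\<lambda>s. ip D (?P (a s)) (\<lambda>\<xi>. ?P (b s) \<xi> * ?P (c s) \<xi>)) has_real_derivative
      ip D f' (\<lambda>\<xi>. g \<tau> \<xi> * h \<tau> \<xi>) + ip D (f \<tau>) (\<lambda>\<xi>. g' \<xi> * h \<tau> \<xi>)
        + ip D (f \<tau>) (\<lambda>\<xi>. g \<tau> \<xi> * h' \<xi>)) (at \<tau> within T)"
    unfolding a(1)[OF \<tau>] b(1)[OF \<tau>] c(1)[OF \<tau>] a(2) b(2) c(2) ip_sum_sum_sum[OF D] .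
  \<comment> \<open>The expansions hold for times in \<open>T\<close> only, which suffices for a
    derivative within \<open>T\<close>; the radius \<open>1\<close> is arbitrary.\<close>
  then show ?thesis
    by (rule has_field_derivative_transform_within[OF _ zero_less_one \<tau>]) (simp add: a b c)
qed

text \<open>At a limit point of \<open>T\<close> derivatives within \<open>T\<close> are unique, so
  the pointwise \<open>ddt\<close> is the polynomial with differentiated coefficients.\<close>

lemma C1_Vh_curve:
  assumes f: "C1_Vh N K T f" and k: "k \<in> {1..K}" and \<tau>: "\<tau> \<in> T" and lim: "\<tau> islimpt T"
  shows "PN_curve N T \<tau> (f k) (ddt T (f k) \<tau>)"
proof -
  obtain c where C1: "\<And>i j. Ck_on 1 (\<lambda>\<tau>. c \<tau> i j) T"
    and c: "\<And>s. s \<in> T \<Longrightarrow> f k s = poly2 N (c s)"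
    using f k unfolding C1_Vh_def by blast
  have "\<exists>d. ((\<lambda>s. c s i j) has_real_derivative d) (at \<tau> within T)" for i j
    using C1[of i j] \<tau> by (auto simp flip: real_differentiable_def intro: differentiableI)
  then obtain c' where c': "\<And>i j. ((\<lambda>s. c s i j) has_real_derivative c' i j) (at \<tau> within T)"
    by metis
  have "ddt T (f k) \<tau> \<xi> = (\<Sum>p\<in>mono_idx N. case_prod c' p * monom2 p \<xi>)" for \<xi>
  proof -
    have "((\<lambda>s. \<Sum>p\<in>mono_idx N. case_prod (c s) p * monom2 p \<xi>) has_real_derivative
        (\<Sum>p\<in>mono_idx N. case_prod c' p * monom2 p \<xi>)) (at \<tau> within T)"
      by (intro DERIV_sum DERIV_cmult_right) (simp add: split_def c')
    then have "((\<lambda>s. f k s \<xi>) has_real_derivative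
        (\<Sum>p\<in>mono_idx N. case_prod c' p * monom2 p \<xi>)) (at \<tau> within T)"
      by (rule has_field_derivative_transform_within[OF _ zero_less_one \<tau>])
        (simp add: c poly2_eq_sum)
    then show ?thesis
      unfolding ddt_def has_real_derivative_iff_has_vector_derivative
      by (rule vector_derivative_within[rotated]) (simp add: trivial_limit_within lim)
  qed
  moreover have "((\<lambda>s. case_prod (c s) p) has_real_derivative case_prod c' p) (at \<tau> within T)" for p
    by (simp add: split_def c')
  ultimately show ?thesis
    unfolding PN_curve_def
    by (intro exI[of _ "\<lambda>s. case_prod (c s)"] exI[of _ "case_prod c'"]) (auto simp: c poly2_eq_sum)
qed

lemma elementwise_energy_derivative:
  assumes D: "compact D" "interior D \<noteq> {}" and \<tau>: "\<tau> \<in> T" and lim: "\<tau> islimpt T"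
    and u: "PN_curve N T \<tau> u u'" and m: "PN_curve N T \<tau> m m'" and J: "PN_curve N T \<tau> J J'"
    and d: "d \<in> PN N"
    and recover: "\<And>s v. s \<in> T \<Longrightarrow> v \<in> PN N \<Longrightarrow> ip D (u s) (\<lambda>\<xi>. v \<xi> * J s \<xi>) = ip D (m s) v"
    and gcl: "\<And>w. w \<in> PN N \<Longrightarrow> ip D J' w + ip D d w = 0"
  shows "((\<lambda>s. 1/2 * ip D (u s) (\<lambda>\<xi>. u s \<xi> * J s \<xi>)) has_real_derivative
      ip D m' (u \<tau>) + 1/2 * ip D (\<lambda>\<xi>. d \<xi> * u \<tau> \<xi>) (u \<tau>)) (at \<tau> within T)"
proof -
  note J' = PN_curve_in_PN(2)[OF J] and u\<tau> = PN_curve_in_PN(1)[OF u \<tau>]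
  \<comment> \<open>The function \<open>u\<^sup>2\<close> has degree \<open>2 * N\<close> and is not a test function of the geometric conservation law,
     so the law is first upgraded to a pointwise identity, with test function \<open>J' + d\<close>.\<close>
  have "(\<lambda>\<xi>. J' \<xi> + d \<xi>) = (\<lambda>_. 0)"
  proof (rule PN_definite[OF PN_add[OF J' d] D])
    show "ip D (\<lambda>\<xi>. J' \<xi> + d \<xi>) (\<lambda>\<xi>. J' \<xi> + d \<xi>) = 0"
      using ip_add_left[OF D(1) continuous_on_PN continuous_on_PN continuous_on_PN, OF J' d PN_add[OF J' d]]
        gcl[OF PN_add[OF J' d]] by simp
  qed
  then have J'_eq: "J' \<xi> = - d \<xi>" for \<xi>
    by (simp add: fun_eq_iff eq_neg_iff_add_eq_0)
  \<comment> \<open>The test function is frozen at \<open>u \<tau>\<close>, since the recovery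
    relation is differentiated for a fixed \<open>v\<close>; the middle slot has derivative
    \<open>0\<close>.\<close>
  have "((\<lambda>s. ip D (u s) (\<lambda>\<xi>. u \<tau> \<xi> * J s \<xi>)) has_real_derivative
      ip D u' (\<lambda>\<xi>. u \<tau> \<xi> * J \<tau> \<xi>) + ip D (u \<tau>) (\<lambda>\<xi>. 0 * J \<tau> \<xi>) + ip D (u \<tau>) (\<lambda>\<xi>. u \<tau> \<xi> * J' \<xi>))
      (at \<tau> within T)"
    by (rule ip_triple_has_derivative[OF D(1) \<tau> u PN_curve_const[OF u\<tau>] J])
  moreover have "((\<lambda>s. ip D (u s) (\<lambda>\<xi>. u \<tau> \<xi> * J s \<xi>)) has_real_derivative ip D m' (u \<tau>))
      (at \<tau> within T)"
  proof -
    \<comment> \<open>The constant \<open>1\<close> turns the pairing with \<open>m\<close> into a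
      triple product, so the same product rule applies.\<close>
    have "((\<lambda>s. ip D (m s) (\<lambda>\<xi>. u \<tau> \<xi> * 1)) has_real_derivative
      ip D m' (\<lambda>\<xi>. u \<tau> \<xi> * 1) + ip D (m \<tau>) (\<lambda>\<xi>. 0 * 1) + ip D (m \<tau>) (\<lambda>\<xi>. u \<tau> \<xi> * 0)) (at \<tau> within T)"
      by (rule ip_triple_has_derivative[OF D(1) \<tau> m PN_curve_const[OF u\<tau>] PN_curve_const[OF PN_one]])
    then have "((\<lambda>s. ip D (m s) (u \<tau>)) has_real_derivative ip D m' (u \<tau>)) (at \<tau> within T)"
      by (simp add: ip_def)
    then show ?thesis
      by (rule has_field_derivative_transform_within[OF _ zero_less_one \<tau>]) (simp add: recover u\<tau>)
  qed
  ultimately have "ip D u' (\<lambda>\<xi>. u \<tau> \<xi> * J \<tau> \<xi>) + ip D (u \<tau>) (\<lambda>\<xi>. 0 * J \<tau> \<xi>)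
      + ip D (u \<tau>) (\<lambda>\<xi>. u \<tau> \<xi> * J' \<xi>) = ip D m' (u \<tau>)"
    unfolding has_real_derivative_iff_has_vector_derivative
    by (intro vector_derivative_unique_within[of \<tau> T]) (simp_all add: trivial_limit_within lim)
  moreover have "ip D (u \<tau>) (\<lambda>\<xi>. 0 * J \<tau> \<xi>) = 0"
    by (simp add: ip_def)
  moreover have "ip D (u \<tau>) (\<lambda>\<xi>. u' \<xi> * J \<tau> \<xi>) = ip D u' (\<lambda>\<xi>. u \<tau> \<xi> * J \<tau> \<xi>)"
    by (simp add: ip_def mult_ac)
  moreover have "ip D (u \<tau>) (\<lambda>\<xi>. u \<tau> \<xi> * J' \<xi>) = - ip D (\<lambda>\<xi>. d \<xi> * u \<tau> \<xi>) (u \<tau>)"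
    using ip_scale_left[of D "-1" "\<lambda>\<xi>. d \<xi> * u \<tau> \<xi>" "u \<tau>"]
    by (simp add: ip_def J'_eq mult_ac)
  \<comment> \<open>The product rule gives \<open>2 (u', u J) + (u, u J')\<close>. Eliminating
    \<open>(u', u J)\<close> turns half of it into \<open>(m', u) - 1/2 (u, u J')\<close>, and
    \<open>J' = - d\<close>.\<close>
  ultimately show ?thesis
    using DERIV_cmult[OF ip_triple_has_derivative[OF D(1) \<tau> u u J], of "1/2"] by (simp add: field_simps)
qed

section \<open>Faces of a conforming triangulation\<close>

definition cross2 :: "point \<Rightarrow> point \<Rightarrow> real" where
  "cross2 a b = a $ 1 * b $ 2 - a $ 2 * b $ 1"

text \<open>Twice the signed area of the triangle; for distinct \<open>p\<close> and
  \<open>q\<close> its sign tells on which side of the line through them \<open>r\<close>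
  lies.\<close>

definition orient :: "point \<Rightarrow> point \<Rightarrow> point \<Rightarrow> real" where
  "orient p q r = cross2 (q - p) (r - p)"

definition rot90 :: "point \<Rightarrow> point" where
  "rot90 a = (\<chi> i. if i = 1 then - (a $ 2) else a $ 1)"

lemma point_eq_iff: "a = b \<longleftrightarrow> a $ 1 = b $ 1 \<and> a $ 2 = b $ 2" for a b :: point
  by (simp add: vec_eq_iff forall_2)

lemma inner_point: "a \<bullet> b = a $ 1 * b $ 1 + a $ 2 * b $ 2" for a b :: point
  by (simp add: inner_vec_def sum_2)

lemma rot90_nth [simp]: "rot90 a $ 1 = - (a $ 2)" "rot90 a $ 2 = a $ 1"
  by (simp_all add: rot90_def)

lemma norm_rot90 [simp]: "norm (rot90 a) = norm a"
  by (simp add: norm_eq_sqrt_inner inner_point)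

lemma inner_rot90: "rot90 a \<bullet> b = cross2 a b"
  by (simp add: inner_point cross2_def)

lemma cross2_self [simp]: "cross2 a a = 0"
  by (simp add: cross2_def)

lemma scaleR_eq_imp_eq_divide:
  fixes a b :: "'a::real_vector"
  assumes "c *\<^sub>R a = d *\<^sub>R b" "c \<noteq> 0"
  shows "a = (d / c) *\<^sub>R b"
proof -
  have "a = inverse c *\<^sub>R (c *\<^sub>R a)" using assms(2) by simp
  then show ?thesis using assms by (simp add: divide_inverse mult.commute)
qed

text \<open>Cramer's rule for the coordinates of \<open>a\<close> in the basis \<open>b\<close>,
  \<open>c\<close>.\<close>

lemma cross2_solve:
  assumes "cross2 b c \<noteq> 0"
  shows "a = (cross2 a c / cross2 b c) *\<^sub>R b + (cross2 b a / cross2 b c) *\<^sub>R c"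
proof -
  have "cross2 b c *\<^sub>R a = cross2 a c *\<^sub>R b + cross2 b a *\<^sub>R c"
    by (simp add: point_eq_iff cross2_def algebra_simps)
  then have "cross2 b c *\<^sub>R a = 1 *\<^sub>R (cross2 a c *\<^sub>R b + cross2 b a *\<^sub>R c)" by simp
  from scaleR_eq_imp_eq_divide[OF this assms] show ?thesis
    by (simp add: scaleR_add_right)
qed

lemma orient_eq_0_imp_collinear:
  assumes "orient p q r = 0"
  shows "collinear {p, q, r}"
proof (cases "p = q")
  case False
  define b where "b = q - p"
  have b: "b \<bullet> b \<noteq> 0" using False by (simp add: b_def)
  \<comment> \<open>A vanishing cross product makes \<open>r - p\<close> equal to its orthogonal
    projection onto the line spanned by \<open>b\<close>.\<close>
  have "(b \<bullet> b) *\<^sub>R (r - p) = (b \<bullet> (r - p)) *\<^sub>R b"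
    using assms unfolding orient_def b_def[symmetric] cross2_def point_eq_iff
    by (simp add: inner_point) algebra
  then have "r - p = ((b \<bullet> (r - p)) / (b \<bullet> b)) *\<^sub>R b"
    using scaleR_eq_imp_eq_divide b by blast
  then have "r = p + ((b \<bullet> (r - p)) / (b \<bullet> b)) *\<^sub>R b"
    by (simp add: algebra_simps)
  moreover have "p = p + 0 *\<^sub>R b" "q = p + 1 *\<^sub>R b"
    by (simp_all add: b_def)
  ultimately show ?thesis
    unfolding collinear_alt by (metis empty_iff insert_iff)
qed (simp add: collinear_2)

text \<open>\<open>t\<close> is unrestricted: a negative value serves later to extrapolate across a
  face.\<close>

lemma orient_affine:
  "orient p q ((1 - t) *\<^sub>R x + t *\<^sub>R y) = (1 - t) * orient p q x + t * orient p q y"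
  by (simp add: orient_def cross2_def algebra_simps)

lemma orient_same [simp]: "orient p q p = 0" "orient p q q = 0"
  by (simp_all add: orient_def cross2_def)

lemma orient_convex_hull_pair: "z \<in> convex hull {p, q} \<Longrightarrow> orient p q z = 0"
  by (auto simp: segment_convex_hull[symmetric] in_segment orient_affine)

lemma orient_triangle_combination:
  assumes "u + v + w = 1"
  shows "orient p q (u *\<^sub>R p + v *\<^sub>R q + w *\<^sub>R r) = w * orient p q r"
proof -
  have u: "u = 1 - v - w" using assms by simp
  show ?thesis
    unfolding u by (simp add: orient_def cross2_def algebra_simps)
qed

text \<open>The closed form depends on the third vertex only through the sign of
  \<open>orient p q r\<close>, which makes the normals of adjacent triangles comparable.\<close>

lemma outward_normal_eq:
  assumes V: "V k = {p, q, r}" and o: "orient p q r \<noteq> 0"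
  shows "outward_normal V k {p, q} = (- sgn (orient p q r) / norm (q - p)) *\<^sub>R rot90 (q - p)"
    (is "_ = ?n")
proof -
  define b where "b = q - p"
  have b: "norm b > 0" and pq: "p \<noteq> q" and r: "r \<notin> {p, q}"
    using o by (auto simp: b_def orient_def cross2_def)
  have o': "orient p q r = cross2 b (r - p)" "cross2 b (r - q) = cross2 b (r - p)"
    by (simp_all add: b_def orient_def cross2_def algebra_simps)
  have VF: "V k - {p, q} = {r}" using V r by auto
  \<comment> \<open>The condition at \<open>q\<close> agrees with the one at \<open>p\<close>,
    because \<open>q - p\<close> is orthogonal to \<open>n\<close>.\<close>
  have char: "(norm n = 1 \<and> (\<forall>p'\<in>{p, q}. \<forall>q'\<in>{p, q}. n \<bullet> (q' - p') = 0) \<and>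
      (\<forall>p'\<in>{p, q}. \<forall>r'\<in>V k - {p, q}. n \<bullet> (r' - p') < 0)) \<longleftrightarrow>
      norm n = 1 \<and> n \<bullet> b = 0 \<and> n \<bullet> (r - p) < 0" for n
    unfolding VF by (auto simp: b_def algebra_simps)
  show ?thesis
    unfolding outward_normal_def char b_def[symmetric]
  proof (rule the_equality)
    have "sgn (orient p q r) * cross2 b (r - p) > 0"
      using o o' by (metis abs_sgn mult.commute zero_less_abs_iff)
    then show "norm ((- sgn (orient p q r) / norm b) *\<^sub>R rot90 b) = 1 \<and>
        (- sgn (orient p q r) / norm b) *\<^sub>R rot90 b \<bullet> b = 0 \<and>
        (- sgn (orient p q r) / norm b) *\<^sub>R rot90 b \<bullet> (r - p) < 0"
      using b o by (simp add: inner_rot90 abs_sgn_eq)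
  next
    fix n assume n: "norm n = 1 \<and> n \<bullet> b = 0 \<and> n \<bullet> (r - p) < 0"
    \<comment> \<open>In the plane the vectors orthogonal to \<open>b\<close> are the multiples of
      \<open>rot90 b\<close>; unit length fixes the absolute value of \<open>t\<close>, and the side
      of \<open>r\<close> its sign.\<close>
    define t where "t = cross2 b n / (b \<bullet> b)"
    have "(b \<bullet> b) *\<^sub>R n = cross2 b n *\<^sub>R rot90 b"
      using n unfolding point_eq_iff by (simp add: inner_point cross2_def) algebra
    then have nt: "n = t *\<^sub>R rot90 b"
      unfolding t_def using b by (intro scaleR_eq_imp_eq_divide) auto
    have "\<bar>t\<bar> * norm b = 1" using n nt by simp
    then have t: "\<bar>t\<bar> = 1 / norm b" using b by (simp add: field_simps)
    have "t * orient p q r < 0" using n nt by (simp add: inner_rot90 o')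
    then have "t = - sgn (orient p q r) / norm b"
      using t by (auto simp: mult_less_0_iff sgn_if abs_if split: if_splits)
    then show "n = (- sgn (orient p q r) / norm b) *\<^sub>R rot90 b" using nt by simp
  qed
qed

lemma convex_hull_3I:
  "0 \<le> u \<Longrightarrow> 0 \<le> v \<Longrightarrow> 0 \<le> w \<Longrightarrow> u + v + w = 1 \<Longrightarrow>
    u *\<^sub>R a + v *\<^sub>R b + w *\<^sub>R c \<in> convex hull {a, b, c}"
  unfolding convex_hull_3 by blast

text \<open>A small move from the midpoint of \<open>p\<close> and \<open>q\<close> towards
  \<open>r\<close> stays in the triangle with \<open>r'\<close>: two barycentric coordinates there
  remain close to \<open>1/2\<close> and the third is positive.\<close>

lemma same_side_triangles_overlap:
  assumes "orient p q r * orient p q r' > 0"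
  shows "\<exists>z. z \<in> convex hull {p, q, r} \<and> z \<in> convex hull {p, q, r'} \<and> orient p q z \<noteq> 0"
proof -
  \<comment> \<open>By Cramer's rule these are the coordinates of \<open>r - p\<close> in the basis
    \<open>q - p\<close>, \<open>r' - p\<close>; the same-side hypothesis makes
    \<open>\<beta>\<close> positive.\<close>
  define \<alpha> where "\<alpha> = cross2 (r - p) (r' - p) / orient p q r'"
  define \<beta> where "\<beta> = orient p q r / orient p q r'"
  have o: "orient p q r \<noteq> 0" "orient p q r' \<noteq> 0" and \<beta>: "\<beta> > 0"
    using assms by (auto simp: \<beta>_def zero_less_mult_iff zero_less_divide_iff)
  have r: "r = (1 - \<alpha> - \<beta>) *\<^sub>R p + \<alpha> *\<^sub>R q + \<beta> *\<^sub>R r'"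
    using cross2_solve[of "q - p" "r' - p" "r - p"] o(2)
    unfolding \<alpha>_def \<beta>_def orient_def by (simp add: algebra_simps)
  \<comment> \<open>Small enough that the barycentric coordinates of \<open>z\<close> are
    nonnegative in both triangles.\<close>
  define \<epsilon> where "\<epsilon> = 1 / (4 * (1 + \<bar>\<alpha>\<bar> + \<beta>))"
  have "\<epsilon> > 0" "\<epsilon> * (4 * (1 + \<bar>\<alpha>\<bar> + \<beta>)) = 1"
    using \<beta> by (auto simp: \<epsilon>_def)
  moreover from this have "4 * \<epsilon> + 4 * (\<epsilon> * \<bar>\<alpha>\<bar>) + 4 * (\<epsilon> * \<beta>) = 1"
    by (simp add: algebra_simps)
  moreover have "\<epsilon> * \<bar>\<alpha>\<bar> \<ge> 0" "\<epsilon> * \<beta> \<ge> 0"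
    using \<beta> \<open>\<epsilon> > 0\<close> by simp_all
  ultimately have \<epsilon>: "0 < \<epsilon>" "\<epsilon> \<le> 1/4" "\<epsilon> * \<bar>\<alpha>\<bar> + \<epsilon> * \<beta> \<le> 1/4"
    by linarith+
  define A B where "A = \<epsilon> * \<alpha>" and "B = \<epsilon> * \<beta>"
  have "\<bar>A\<bar> = \<epsilon> * \<bar>\<alpha>\<bar>" using \<epsilon>(1) by (simp add: A_def abs_mult)
  then have AB: "\<bar>A\<bar> + B \<le> 1/4" "B > 0"
    using \<epsilon> \<beta> by (simp_all add: B_def)
  define z where "z = ((1 - \<epsilon>) / 2) *\<^sub>R p + ((1 - \<epsilon>) / 2) *\<^sub>R q + \<epsilon> *\<^sub>R r"
  have "z \<in> convex hull {p, q, r}"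
    unfolding z_def by (rule convex_hull_3I) (use \<epsilon> in auto)
  moreover have "z = ((1 - \<epsilon>) / 2 + (\<epsilon> - A - B)) *\<^sub>R p + ((1 - \<epsilon>) / 2 + A) *\<^sub>R q + B *\<^sub>R r'"
    unfolding z_def A_def B_def by (subst r) (simp add: algebra_simps)
  moreover have "\<dots> \<in> convex hull {p, q, r'}"
    by (rule convex_hull_3I) (use \<epsilon>(1,2) AB in \<open>auto simp: field_simps\<close>)
  moreover have "orient p q z = \<epsilon> * orient p q r"
    unfolding z_def by (rule orient_triangle_combination) simp
  ultimately show ?thesis using \<epsilon> o by auto
qed

lemma face_vertices:
  assumes "card (V k) = 3" "F \<in> faces V k"
  obtains p q r where "F = {p, q}" "V k = {p, q, r}" "p \<noteq> q" "r \<notin> {p, q}"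
proof -
  have F: "F \<subseteq> V k" "card F = 2" using assms by (auto simp: faces_def)
  obtain p q where pq: "F = {p, q}" "p \<noteq> q" using F(2) by (meson card_2_iff)
  have fin: "finite (V k)" using assms(1) by (metis card.infinite zero_neq_numeral)
  then have "card (V k - F) = 1" using F assms(1) by (simp add: card_Diff_subset finite_subset)
  then obtain r where r: "V k - F = {r}" by (meson card_1_singletonE)
  show ?thesis
    using that[of p q r] pq r F(1) by blast
qed

text \<open>Continuity of the normal component is available only on the face, so the integrands of
  the two sides are compared only there.\<close>

lemma face_integral_cong:
  assumes "\<And>\<xi>. \<xi> \<in> convex hull F \<Longrightarrow> f \<xi> = g \<xi>"
  shows "face_integral F f = face_integral F g"
proof -
  have "(LINT s:{0..1}|lborel. f ((1 - s) *\<^sub>R p + s *\<^sub>R q)) =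
      (LINT s:{0..1}|lborel. g ((1 - s) *\<^sub>R p + s *\<^sub>R q))" if "p \<in> F" "q \<in> F" for p q
  proof (rule set_lebesgue_integral_cong)
    show "\<forall>s. s \<in> {0..1} \<longrightarrow> f ((1 - s) *\<^sub>R p + s *\<^sub>R q) = g ((1 - s) *\<^sub>R p + s *\<^sub>R q)"
      using that by (auto intro!: assms convexD_alt[OF convex_convex_hull] intro: hull_inc)
  qed simp
  then show ?thesis
    unfolding face_integral_def by (intro arg_cong2[of _ _ _ _ "(*)"] sum.cong refl) simp
qed

lemma face_integral_uminus: "face_integral F (\<lambda>\<xi>. - f \<xi>) = - face_integral F f"
  by (simp add: face_integral_def set_lebesgue_integral_def sum_negf)

section \<open>Neighbouring elements of a conforming mesh\<close>

context
  fixes \<Omega> :: "point set" and K :: nat and V :: "nat \<Rightarrow> point set"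
  assumes mesh: "conforming_mesh \<Omega> K V"
begin

lemma mesh_triangle:
  assumes "k \<in> {1..K}"
  shows "card (V k) = 3" "\<not> collinear (V k)"
  using mesh assms by (auto simp: conforming_mesh_def)

lemma mesh_Int:
  assumes "k \<in> {1..K}" "l \<in> {1..K}" "k \<noteq> l"
  shows "V k \<noteq> V l" "elem V k \<inter> elem V l = convex hull (V k \<inter> V l)"
  using mesh assms unfolding conforming_mesh_def by blast+

lemma mesh_compact_elem: "k \<in> {1..K} \<Longrightarrow> compact (elem V k)"
  unfolding elem_def using mesh_triangle(1)
  by (intro finite_imp_compact_convex_hull) (metis card.infinite zero_neq_numeral)

lemma mesh_interior_elem:
  assumes k: "k \<in> {1..K}"
  shows "interior (elem V k) \<noteq> {}"
proof -
  obtain a b c where abc: "V k = {a, b, c}"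
    using mesh_triangle(1)[OF k] by (auto simp: card_3_iff)
  have "\<not> affine_dependent (V k)"
    using mesh_triangle[OF k] unfolding abc collinear_3_eq_affine_dependent by blast
  then show ?thesis
    unfolding elem_def using mesh_triangle(1)[OF k]
    by (subst interior_convex_hull_eq_empty) simp_all
qed

text \<open>With \<open>r\<close> and \<open>r'\<close> on the same side, the triangles would share
  a point off the line through \<open>p\<close> and \<open>q\<close>, whereas conformity confines
  their intersection to the common segment.\<close>

lemma shared_face_opposite:
  assumes k: "k \<in> {1..K}" and l: "l \<in> {1..K}" and "k \<noteq> l"
    and Vk: "V k = {p, q, r}" and Vl: "V l = {p, q, r'}"
  shows "orient p q r * orient p q r' < 0"
proof -
  have o: "orient p q r \<noteq> 0" "orient p q r' \<noteq> 0"
    using mesh_triangle(2)[OF k] mesh_triangle(2)[OF l] orient_eq_0_imp_collinear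
    by (auto simp: Vk Vl)
  have "\<not> orient p q r * orient p q r' > 0"
  proof
    assume "orient p q r * orient p q r' > 0"
    then obtain z where z: "z \<in> elem V k \<inter> elem V l" "orient p q z \<noteq> 0"
      using same_side_triangles_overlap unfolding elem_def Vk Vl by blast
    have "V k \<inter> V l = {p, q}"
      using mesh_Int(1)[OF k l \<open>k \<noteq> l\<close>] o unfolding Vk Vl by auto
    then show False
      using mesh_Int(2)[OF k l \<open>k \<noteq> l\<close>] z orient_convex_hull_pair by auto
  qed
  then show ?thesis using o by (simp add: not_less less_le)
qed

text \<open>With the end points labelled alike for both triangles, the closed forms of the normals
  differ only in the sign of \<open>orient\<close>, and the third vertices lie on opposite
  sides.\<close>

lemma shared_face_normal:
  assumes k: "k \<in> {1..K}" and l: "l \<in> {1..K}" and "k \<noteq> l"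
    and F: "F \<in> faces V k" "F \<in> faces V l"
  shows "outward_normal V l F = - outward_normal V k F"
proof -
  obtain p q r where Fk: "F = {p, q}" "V k = {p, q, r}" "p \<noteq> q" "r \<notin> {p, q}"
    using face_vertices[OF mesh_triangle(1)[OF k] F(1)] .
  have "F \<subseteq> V l" using F(2) by (simp add: faces_def)
  obtain p' q' r' where "F = {p', q'}" "V l = {p', q', r'}"
    using face_vertices[OF mesh_triangle(1)[OF l] F(2)] .
  then have Vl: "V l = {p, q, r'}" using Fk(1) by auto
  have "orient p q r * orient p q r' < 0"
    using shared_face_opposite[OF k l \<open>k \<noteq> l\<close> Fk(2) Vl] .
  then have "sgn (orient p q r') = - sgn (orient p q r)" "orient p q r \<noteq> 0" "orient p q r' \<noteq> 0"
    by (auto simp: mult_less_0_iff)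
  then show ?thesis
    unfolding Fk(1) by (simp add: outward_normal_eq[of V k p q r, OF Fk(2)] outward_normal_eq[of V l p q r', OF Vl])
qed

text \<open>Two neighbours of \<open>D\<^sup>k\<close> across \<open>F\<close> would lie on opposite sides of \<open>F\<close>, and both opposite to \<open>D\<^sup>k\<close>.\<close>

lemma face_neighbour_unique:
  assumes k: "k \<in> {1..K}" and l: "l \<in> {1..K}" "l \<noteq> k" and l': "l' \<in> {1..K}" "l' \<noteq> k"
    and F: "F \<in> faces V k" "F \<in> faces V l" "F \<in> faces V l'"
  shows "l = l'"
proof (rule ccontr)
  assume "l \<noteq> l'"
  then have "outward_normal V k F = - outward_normal V k F"
    using shared_face_normal[of k l F] shared_face_normal[of k l' F] shared_face_normal[of l l' F] assms
    by simp
  then have "2 *\<^sub>R outward_normal V k F = 0"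
    by (metis add.right_inverse scaleR_2)
  then have 0: "outward_normal V k F = 0" by simp
  obtain p q r where Fk: "F = {p, q}" "V k = {p, q, r}" "p \<noteq> q" "r \<notin> {p, q}"
    using face_vertices[OF mesh_triangle(1)[OF k] F(1)] .
  have o: "orient p q r \<noteq> 0"
    using mesh_triangle(2)[OF k] orient_eq_0_imp_collinear by (auto simp: Fk)
  have "norm (outward_normal V k F) = 1"
    unfolding Fk(1) outward_normal_eq[of V k p q r, OF Fk(2) o] using o Fk(3) by (simp add: abs_sgn_eq)
  then show False using 0 by simp
qed

text \<open>
  Points just across \<open>F\<close> lie in \<open>\<Omega>\<close> but not in \<open>D\<^sup>k\<close>, so a point \<open>x\<close> of the open segment is a limit of points of
  the other, finitely many and closed, elements; conformity then makes \<open>F\<close> a face of the one containing \<open>x\<close>.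
\<close>

lemma face_neighbour_exists:
  assumes k: "k \<in> {1..K}" and F: "F \<in> faces V k" and int: "\<not> convex hull F \<subseteq> frontier \<Omega>"
  shows "\<exists>l. l \<in> {1..K} \<and> l \<noteq> k \<and> F \<in> faces V l"
proof -
  obtain p q r where Fk: "F = {p, q}" "V k = {p, q, r}" "p \<noteq> q" "r \<notin> {p, q}"
    using face_vertices[OF mesh_triangle(1)[OF k] F] .
  have o: "orient p q r \<noteq> 0"
    using mesh_triangle(2)[OF k] orient_eq_0_imp_collinear by (auto simp: Fk)
  have \<Omega>: "open \<Omega>" "closure \<Omega> = (\<Union>k\<in>{1..K}. elem V k)"
    using mesh by (auto simp: conforming_mesh_def)
  have "convex hull F \<subseteq> elem V k"
    unfolding elem_def Fk by (intro hull_mono) auto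
  then have "convex hull F \<subseteq> closure \<Omega>" using \<Omega>(2) k by blast
  then obtain x0 where x0: "x0 \<in> convex hull F" "x0 \<in> \<Omega>"
    using int \<Omega>(1) by (auto simp: frontier_def interior_open)
  have "x0 \<in> closure (open_segment p q)"
    using x0(1) Fk by (simp add: segment_convex_hull)
  \<comment> \<open>\<open>x0\<close> may be an end point, where another element could meet
    \<open>F\<close> in that vertex alone; as \<open>\<Omega>\<close> is open, it can be moved into
    the open segment.\<close>
  then obtain x where x: "x \<in> open_segment p q" "x \<in> \<Omega>"
    using x0(2) \<Omega>(1) by (meson closure_iff_nhds_not_empty disjoint_iff order_refl open_Int_closure_eq_empty)
  define U where "U = (\<Union>l\<in>{1..K} - {k}. elem V l)"
  have "closed U"
    unfolding U_def by (intro closed_UN ballI compact_imp_closed mesh_compact_elem) auto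
  \<comment> \<open>\<open>y\<close> moves from \<open>x\<close> straight away from
    \<open>r\<close>, so \<open>orient p q\<close> takes the sign opposite to that of
    \<open>r\<close>.\<close>
  define y where "y = (\<lambda>t::real. x - t *\<^sub>R (r - x))"
  have lim: "(y \<longlongrightarrow> x) (at_right 0)"
  proof -
    have "(y \<longlongrightarrow> x - 0 *\<^sub>R (r - x)) (at_right 0)"
      unfolding y_def by (intro tendsto_intros)
    then show ?thesis by simp
  qed
  have "x \<in> convex hull {p, q}"
    using x(1) by (simp add: open_segment_def segment_convex_hull)
  then have ox: "orient p q x = 0" by (rule orient_convex_hull_pair)
  have "\<forall>\<^sub>F t in at_right 0. y t \<in> U"
  proof -
    have "\<forall>\<^sub>F t in at_right 0. y t \<in> \<Omega>"
      using topological_tendstoD[OF lim \<Omega>(1) x(2)] .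
    moreover have "\<forall>\<^sub>F t::real in at_right 0. t > 0"
      by (rule eventually_at_right_less)
    ultimately show ?thesis
    proof eventually_elim
      case (elim t)
      have "y t = (1 - (- t)) *\<^sub>R x + (- t) *\<^sub>R r"
        by (simp add: y_def algebra_simps)
      then have oy: "orient p q (y t) = - t * orient p q r"
        using orient_affine[of p q "- t" x r] ox by simp
      have "y t \<notin> elem V k"
      proof
        assume "y t \<in> elem V k"
        then obtain a b c where abc: "0 \<le> c" "a + b + c = 1" "y t = a *\<^sub>R p + b *\<^sub>R q + c *\<^sub>R r"
          unfolding elem_def Fk convex_hull_3 by auto
        then have "(c + t) * orient p q r = 0"
          using oy orient_triangle_combination[OF abc(2), of p q r] by (simp add: algebra_simps)
        then show False using o abc(1) elim(2) by simp
      qed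
      moreover have "y t \<in> closure \<Omega>" using elim(1) closure_subset by blast
      ultimately show ?case unfolding U_def \<Omega>(2) by auto
    qed
  qed
  then have "x \<in> U"
    by (rule Lim_in_closed_set[OF \<open>closed U\<close> _ _ lim]) simp
  then obtain l where l: "l \<in> {1..K}" "l \<noteq> k" "x \<in> elem V l" unfolding U_def by blast
  have "x \<in> elem V k"
    using \<open>x \<in> convex hull {p, q}\<close> \<open>convex hull F \<subseteq> elem V k\<close> Fk(1) by blast
  then have "x \<in> convex hull (V k \<inter> V l)"
    using mesh_Int(2)[OF k l(1) l(2)[symmetric]] l(3) by blast
  \<comment> \<open>Affine independence of the union makes the intersection of the two hulls the
    hull of the common vertices.\<close>
  moreover have "\<not> affine_dependent ({p, q} \<union> (V k \<inter> V l))"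
  proof -
    have "\<not> affine_dependent {p, q, r}"
      using mesh_triangle(2)[OF k] Fk unfolding Fk(2) collinear_3_eq_affine_dependent by blast
    then show ?thesis
      by (rule contrapos_nn) (erule affine_dependent_subset, use Fk in auto)
  qed
  ultimately have xF: "x \<in> convex hull ({p, q} \<inter> (V k \<inter> V l))"
    using convex_hull_Int_subset \<open>x \<in> convex hull {p, q}\<close> by blast
  \<comment> \<open>Since \<open>x\<close> is neither end point, a hull of end points that contains
    it needs both of them.\<close>
  have xpq: "x \<noteq> p" "x \<noteq> q" using x(1) by (auto simp: open_segment_def)
  have "p \<in> V l" "q \<in> V l"
  proof -
    show "p \<in> V l"
    proof (rule ccontr)
      assume "p \<notin> V l"
      then have "{p, q} \<inter> (V k \<inter> V l) \<subseteq> {q}" by auto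
      then show False using hull_mono[of "{p, q} \<inter> (V k \<inter> V l)" "{q}" convex] xF xpq by auto
    qed
    show "q \<in> V l"
    proof (rule ccontr)
      assume "q \<notin> V l"
      then have "{p, q} \<inter> (V k \<inter> V l) \<subseteq> {p}" by auto
      then show False using hull_mono[of "{p, q} \<inter> (V k \<inter> V l)" "{p}" convex] xF xpq by auto
    qed
  qed
  then have "F \<in> faces V l"
    using Fk by (simp add: faces_def)
  then show ?thesis using l by blast
qed

text \<open>Evaluates the definite description in \<open>ext_trace\<close> from both sides, so that
  crossing the face twice leads back to \<open>k\<close>.\<close>

lemma mesh_neighbour:
  assumes k: "k \<in> {1..K}" and F: "F \<in> faces V k" and int: "\<not> convex hull F \<subseteq> frontier \<Omega>"
  obtains l where "l \<in> {1..K}" "l \<noteq> k" "F \<in> faces V l"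
    "(THE l. l \<in> {1..K} \<and> l \<noteq> k \<and> F \<in> faces V l) = l"
    "(THE k. k \<in> {1..K} \<and> k \<noteq> l \<and> F \<in> faces V k) = k"
proof -
  obtain l where l: "l \<in> {1..K}" "l \<noteq> k" "F \<in> faces V l"
    using face_neighbour_exists[OF assms] by blast
  moreover have "(THE l. l \<in> {1..K} \<and> l \<noteq> k \<and> F \<in> faces V l) = l"
    by (rule the_equality) (use l face_neighbour_unique[OF k _ _ _ _ F] in blast)+
  moreover have "(THE k. k \<in> {1..K} \<and> k \<noteq> l \<and> F \<in> faces V k) = k"
    by (rule the_equality) (use k F l face_neighbour_unique[OF l(1) _ _ _ _ l(3)] in blast)+
  ultimately show ?thesis using that by blast
qed

lemma sum_boundary_terms_eq_0:
  fixes u :: "nat \<Rightarrow> point \<Rightarrow> real" and g :: "nat \<Rightarrow> point \<Rightarrow> point"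
  assumes g: "\<And>k l F \<xi>. k \<in> {1..K} \<Longrightarrow> l \<in> {1..K} \<Longrightarrow> k \<noteq> l \<Longrightarrow> F \<in> faces V k \<inter> faces V l \<Longrightarrow>
      \<xi> \<in> convex hull F \<Longrightarrow> g k \<xi> \<bullet> outward_normal V k F = g l \<xi> \<bullet> outward_normal V k F"
  shows "(\<Sum>k=1..K. bd_ip V k (\<lambda>F \<xi>. ext_trace \<Omega> K V u k F \<xi> * (g k \<xi> \<bullet> outward_normal V k F)) (u k)) = 0"
proof -
  define S where "S = (SIGMA k:{1..K}. faces V k)"
  define I where "I = (\<lambda>(k, F). face_integral F
      (\<lambda>\<xi>. ext_trace \<Omega> K V u k F \<xi> * (g k \<xi> \<bullet> outward_normal V k F) * u k \<xi>))"
  define \<phi> where "\<phi> = (\<lambda>(k, F). if convex hull F \<subseteq> frontier \<Omega> then (k, F)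
      else (THE l. l \<in> {1..K} \<and> l \<noteq> k \<and> F \<in> faces V l, F))"
  have fin: "finite (faces V k)" if "k \<in> {1..K}" for k
  proof -
    have "finite (V k)" using mesh_triangle(1)[OF that] by (metis card.infinite zero_neq_numeral)
    then show ?thesis unfolding faces_def by simp
  qed
  \<comment> \<open>The involution \<open>\<phi>\<close> passes to the same face seen from the other side, where the normal is reversed
     and the interior and exterior traces are swapped.\<close>
  have \<phi>: "\<phi> x \<in> S \<and> \<phi> (\<phi> x) = x \<and> I (\<phi> x) = - I x" if "x \<in> S" for x
  proof -
    obtain k F where x: "x = (k, F)" "k \<in> {1..K}" "F \<in> faces V k"
      using \<open>x \<in> S\<close> unfolding S_def by blast
    show ?thesis
    proof (cases "convex hull F \<subseteq> frontier \<Omega>")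
      case True
      then have "\<phi> x = x" "I x = 0"
        by (simp_all add: \<phi>_def x I_def ext_trace_def face_integral_def set_lebesgue_integral_def)
      then show ?thesis using that by simp
    next
      case False
      obtain l where l: "l \<in> {1..K}" "l \<noteq> k" "F \<in> faces V l"
        and THE_l: "(THE l. l \<in> {1..K} \<and> l \<noteq> k \<and> F \<in> faces V l) = l"
        and THE_k: "(THE k. k \<in> {1..K} \<and> k \<noteq> l \<and> F \<in> faces V k) = k"
        using mesh_neighbour[OF x(2,3) False] .
      have \<phi>_eq: "\<phi> (k, F) = (l, F)" "\<phi> (l, F) = (k, F)"
        unfolding \<phi>_def using False THE_l THE_k by simp_all
      have ext: "ext_trace \<Omega> K V u k F = u l" "ext_trace \<Omega> K V u l F = u k"
        unfolding ext_trace_def fun_eq_iff THE_l THE_k using False by simp_all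
      have "I (l, F) = face_integral F (\<lambda>\<xi>. - (u l \<xi> * (g k \<xi> \<bullet> outward_normal V k F) * u k \<xi>))"
        unfolding I_def prod.case ext
      proof (rule face_integral_cong)
        fix \<xi> assume \<xi>: "\<xi> \<in> convex hull F"
        have "g l \<xi> \<bullet> outward_normal V l F = - (g k \<xi> \<bullet> outward_normal V k F)"
          using g[OF x(2) l(1) l(2)[symmetric] _ \<xi>] shared_face_normal[OF x(2) l(1) l(2)[symmetric] x(3) l(3)]
            x(3) l(3) by simp
        then show "u k \<xi> * (g l \<xi> \<bullet> outward_normal V l F) * u l \<xi> =
            - (u l \<xi> * (g k \<xi> \<bullet> outward_normal V k F) * u k \<xi>)"
          by simp
      qed
      also have "\<dots> = - I (k, F)"
        unfolding I_def prod.case ext face_integral_uminus ..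
      finally show ?thesis
        using \<phi>_eq l by (simp add: x(1) S_def)
    qed
  qed
  \<comment> \<open>Reindexing along \<open>\<phi>\<close> equates the sum with its own negative;
    boundary faces are fixed points with zero integral.\<close>
  have "sum I S = (\<Sum>x\<in>S. - I x)"
    by (rule sum.reindex_bij_witness[of S \<phi> \<phi>]) (use \<phi> in auto)
  then have "sum I S = 0" by (simp add: sum_negf)
  then show ?thesis
    unfolding S_def I_def bd_ip_def by (subst sum.Sigma) (auto intro: fin)
qed

end

section \<open>Energy conservation\<close>

theorem theorem4p1:
  fixes N K :: nat
    and T :: "real set"
    and \<Omega> :: "point set"
    and V :: "nat \<Rightarrow> point set"
    and X :: "real \<Rightarrow> point \<Rightarrow> point"
    and G :: "nat \<Rightarrow> real \<Rightarrow> point \<Rightarrow> point"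
    and m J u d :: "nat \<Rightarrow> real \<Rightarrow> point \<Rightarrow> real"
  assumes time: "is_interval T" "interior T \<noteq> {}"
    and mesh: "conforming_mesh \<Omega> K V"
    and map: "moving_map T \<Omega> K V X"
    and field: "ale_field T K V X G"
    and d_eq: "\<And>k \<tau>. k \<in> {1..K} \<Longrightarrow> \<tau> \<in> T \<Longrightarrow> d k \<tau> = proj_dvg N (elem V k) (G k \<tau>)"
    and m_C1: "C1_Vh N K T m"
    and J_C1: "C1_Vh N K T J"
    and u_C1: "C1_Vh N K T u"
    and J_pos: "\<And>k \<tau> \<xi>. k \<in> {1..K} \<Longrightarrow> \<tau> \<in> T \<Longrightarrow> \<xi> \<in> elem V k \<Longrightarrow> J k \<tau> \<xi> > 0"
    and recover: "\<And>k \<tau> v. k \<in> {1..K} \<Longrightarrow> \<tau> \<in> T \<Longrightarrow> v \<in> PN N \<Longrightarrow>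
        ip (elem V k) (u k \<tau>) (\<lambda>\<xi>. v \<xi> * J k \<tau> \<xi>) = ip (elem V k) (m k \<tau>) v"
    and scheme_m: "\<And>k \<tau> v. k \<in> {1..K} \<Longrightarrow> \<tau> \<in> T \<Longrightarrow> v \<in> PN N \<Longrightarrow>
        ip (elem V k) (ddt T (m k) \<tau>) v
        + 1/2 * bd_ip V k
            (\<lambda>F \<xi>. ext_trace \<Omega> K V (\<lambda>l. u l \<tau>) k F \<xi> * (G k \<tau> \<xi> \<bullet> outward_normal V k F)) v
        + 1/2 * (ip (elem V k) (\<lambda>\<xi>. d k \<tau> \<xi> * u k \<tau> \<xi>) v
                 + ip (elem V k) (\<lambda>\<xi>. G k \<tau> \<xi> \<bullet> grad (u k \<tau>) \<xi>) v
                 - ip (elem V k) (\<lambda>\<xi>. u k \<tau> \<xi> *\<^sub>R G k \<tau> \<xi>) (grad v)) = 0"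
    and scheme_J: "\<And>k \<tau> w. k \<in> {1..K} \<Longrightarrow> \<tau> \<in> T \<Longrightarrow> w \<in> PN N \<Longrightarrow>
        ip (elem V k) (ddt T (J k) \<tau>) w + ip (elem V k) (d k \<tau>) w = 0"
  shows "\<forall>\<tau>\<in>T. ((\<lambda>s. 1/2 * norm_J_sq K V (\<lambda>k. J k s) (\<lambda>k. u k s)) has_real_derivative 0)
                  (at \<tau> within T)"
proof
  fix \<tau> assume \<tau>: "\<tau> \<in> T"
  \<comment> \<open>A nondegenerate interval consists of limit points, so derivatives within
    \<open>T\<close> are unique even at an end point, where they are one-sided.\<close>
  have lim: "\<tau> islimpt T"
  proof (rule connected_imp_perfect[OF _ \<tau>])
    show "connected T" using time(1) by (rule is_interval_connected)
    show "T \<noteq> {x}" for x using time(2) by (metis interior_singleton)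
  qed
  let ?B = "\<lambda>k. bd_ip V k (\<lambda>F \<xi>. ext_trace \<Omega> K V (\<lambda>l. u l \<tau>) k F \<xi> *
      (G k \<tau> \<xi> \<bullet> outward_normal V k F)) (u k \<tau>)"
  have elem: "((\<lambda>s. 1/2 * ip (elem V k) (u k s) (\<lambda>\<xi>. u k s \<xi> * J k s \<xi>)) has_real_derivative
      - 1/2 * ?B k) (at \<tau> within T)" if k: "k \<in> {1..K}" for k
  proof -
    let ?D = "elem V k"
    note D = mesh_compact_elem[OF mesh k] mesh_interior_elem[OF mesh k]
    note curve = C1_Vh_curve[OF _ k \<tau> lim]
    have "continuous_on ?D (G k \<tau>)"
      using field k \<tau> unfolding ale_field_def smooth_on_def by (metis Ck_on.simps(1))
    then have d: "d k \<tau> \<in> PN N"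
      unfolding d_eq[OF k \<tau>] by (rule proj_dvg_in_PN[OF D])
    have "((\<lambda>s. 1/2 * ip ?D (u k s) (\<lambda>\<xi>. u k s \<xi> * J k s \<xi>)) has_real_derivative
        ip ?D (ddt T (m k) \<tau>) (u k \<tau>) + 1/2 * ip ?D (\<lambda>\<xi>. d k \<tau> \<xi> * u k \<tau> \<xi>) (u k \<tau>))
        (at \<tau> within T)"
      by (rule elementwise_energy_derivative[OF D \<tau> lim curve[OF u_C1] curve[OF m_C1] curve[OF J_C1]
            d recover[OF k] scheme_J[OF k \<tau>]])
    moreover have "ip ?D (\<lambda>\<xi>. G k \<tau> \<xi> \<bullet> grad (u k \<tau>) \<xi>) (u k \<tau>) =
        ip ?D (\<lambda>\<xi>. u k \<tau> \<xi> *\<^sub>R G k \<tau> \<xi>) (grad (u k \<tau>))"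
      by (simp add: ip_def mult.commute)
    ultimately show ?thesis
      using scheme_m[OF k \<tau> PN_curve_in_PN(1)[OF curve[OF u_C1] \<tau>]]
      by (elim DERIV_cong) (simp add: algebra_simps)
  qed
  have "(\<Sum>k=1..K. - 1/2 * ?B k) = - 1/2 * (\<Sum>k=1..K. ?B k)"
    by (rule sum_distrib_left[symmetric])
  also have "(\<Sum>k=1..K. ?B k) = 0"
  proof (rule sum_boundary_terms_eq_0[OF mesh])
    fix k l F \<xi>
    assume "k \<in> {1..K}" "l \<in> {1..K}" "k \<noteq> l" "F \<in> faces V k \<inter> faces V l" "\<xi> \<in> convex hull F"
    then show "G k \<tau> \<xi> \<bullet> outward_normal V k F = G l \<tau> \<xi> \<bullet> outward_normal V k F"
      using field \<tau> unfolding ale_field_def by blast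
  qed
  finally have zero: "(\<Sum>k=1..K. - 1/2 * ?B k) = 0" by simp
  have "((\<lambda>s. \<Sum>k=1..K. 1/2 * ip (elem V k) (u k s) (\<lambda>\<xi>. u k s \<xi> * J k s \<xi>))
      has_real_derivative (\<Sum>k=1..K. - 1/2 * ?B k)) (at \<tau> within T)"
    by (rule DERIV_sum) (rule elem)
  then show "((\<lambda>s. 1/2 * norm_J_sq K V (\<lambda>k. J k s) (\<lambda>k. u k s)) has_real_derivative 0) (at \<tau> within T)"
    unfolding norm_J_sq_def sum_distrib_left zero .
qed

end
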